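(* Let $G$ be a non-cyclic group of even order $n=2^{\alpha}m$, with $m$ an odd integer. Then the following statements hold. (1) If $\alpha=1$, then $\frac{\psi(G)}{\psi(C_n)}\leq \frac{13}{21}=\frac{\psi(S_3)}{\psi(C_6)}$. (2) If $\alpha=2$, then $\frac{\psi(G)}{\psi(C_n)}\leq \frac{7}{11}=\frac{\psi(C_2\times C_2)}{\psi(C_4)}$. (3) If $\alpha=3$, then $\frac{\psi(G)}{\psi(C_n)}\leq \frac{27}{43}=\frac{\psi(Q_8)}{\psi(C_8)}$. (4) If $\alpha\geq 4$, then $\frac{\psi(G)}{\psi(C_n)}\leq \frac{2^{2\alpha+3}+7}{7(2^{2\alpha+1}+1)}=\frac{\psi(G_1)}{\psi(C_{2^{\alpha}\cdot 3})}$, where $Q_8$ is the quaternion group of order $8$ and $G_1=\langle a,b\mid a^{2^{\alpha}}=b^3=1,\ b^a=b^{-1}\rangle$. In particular, these upper bounds are best possible.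
   Context: For a finite group $G$, $\psi(G)=\sum_{x\in G}o(x)$, where $o(x)$ is the order of $x$. $C_t$ denotes the cyclic group of order $t$; $S_3$ is the symmetric group on three letters; $b^a=a^{-1}ba$. "Best possible" means that in each case (for each $\alpha$) the bound is attained by some non-cyclic group satisfying the hypotheses, namely the group appearing in the displayed equality. *)

theory Defs
  imports "HOL-Algebra.Multiplicative_Group" "HOL-Algebra.Elementary_Groups" "HOL-Algebra.Sym_Groups"
begin

definition psi :: "('a, 'b) monoid_scheme \<Rightarrow> nat"
  where "psi G = (\<Sum>x\<in>carrier G. group.ord G x)"

definition noncyclic_even_group :: "'a monoid \<Rightarrow> nat \<Rightarrow> nat \<Rightarrow> nat \<Rightarrow> bool"
  where "noncyclic_even_group G n \<alpha> m \<longleftrightarrow>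
    group G \<and> finite (carrier G) \<and> \<not> cyclic_group G \<and>
    order G = n \<and> even n \<and> n = 2 ^ \<alpha> * m \<and> odd m"


section \<open>The quaternion group of order 8\<close>

text \<open>The tuple \<open>(a, b, c, d)\<close> stands for the quaternion \<open>a + b i + c j + d k\<close>.\<close>

type_synonym int_quaternion = "int \<times> int \<times> int \<times> int"

fun hamilton_mult :: "int_quaternion \<Rightarrow> int_quaternion \<Rightarrow> int_quaternion" where
  "hamilton_mult (a, b, c, d) (a', b', c', d') =
     (a * a' - b * b' - c * c' - d * d',
      a * b' + b * a' + c * d' - d * c',
      a * c' - b * d' + c * a' + d * b',
      a * d' + b * c' - c * b' + d * a')"

definition quaternion_group :: "int_quaternion monoid"
  where "quaternion_group =
    \<lparr>carrier = {(1, 0, 0, 0), (-1, 0, 0, 0), (0, 1, 0, 0), (0, -1, 0, 0),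
                (0, 0, 1, 0), (0, 0, -1, 0), (0, 0, 0, 1), (0, 0, 0, -1)},
     monoid.mult = hamilton_mult,
     one = (1, 0, 0, 0)\<rparr>"


section \<open>Groups given by a presentation\<close>

datatype 'g letter = Gen 'g | GenInv 'g

type_synonym 'g word = "'g letter list"

text \<open>The least congruence on words that contains the relations \<open>R\<close> and makes \<open>GenInv g\<close>
  inverse to \<open>Gen g\<close>. The set of generators is the whole type \<open>'g\<close>, and a pair \<open>(u, v)\<close> in
  \<open>R\<close> stands for the relation \<open>u = v\<close>.\<close>

inductive word_eq :: "('g word \<times> 'g word) set \<Rightarrow> 'g word \<Rightarrow> 'g word \<Rightarrow> bool"
  for R :: "('g word \<times> 'g word) set" where
  word_eq_refl: "word_eq R u u"
| word_eq_sym: "word_eq R u v \<Longrightarrow> word_eq R v u"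
| word_eq_trans: "word_eq R u v \<Longrightarrow> word_eq R v w \<Longrightarrow> word_eq R u w"
| word_eq_append: "word_eq R u u' \<Longrightarrow> word_eq R v v' \<Longrightarrow> word_eq R (u @ v) (u' @ v')"
| word_eq_right_inv: "word_eq R [Gen g, GenInv g] []"
| word_eq_left_inv: "word_eq R [GenInv g, Gen g] []"
| word_eq_relation: "(u, v) \<in> R \<Longrightarrow> word_eq R u v"

definition word_rel :: "('g word \<times> 'g word) set \<Rightarrow> ('g word \<times> 'g word) set"
  where "word_rel R = {(u, v). word_eq R u v}"

definition presented_group :: "('g word \<times> 'g word) set \<Rightarrow> 'g word set monoid"
  where "presented_group R =
    \<lparr>carrier = UNIV // word_rel R,
     monoid.mult = (\<lambda>U V. \<Union>u\<in>U. \<Union>v\<in>V. word_rel R `` {u @ v}),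
     one = word_rel R `` {[]}\<rparr>"

lemma equiv_word_rel: "equiv UNIV (word_rel R)"
proof (rule equivI)
  show "refl (word_rel R)"
    by (simp add: word_rel_def refl_on_def word_eq_refl)
  show "sym (word_rel R)"
    by (simp add: word_rel_def sym_def word_eq_sym)
  show "trans (word_rel R)"
    unfolding word_rel_def trans_def by (blast intro: word_eq_trans)
qed simp

lemma mult_presented_group:
  "word_rel R `` {u} \<otimes>\<^bsub>presented_group R\<^esub> word_rel R `` {v} = word_rel R `` {u @ v}"
proof -
  have "congruent2 (word_rel R) (word_rel R) (\<lambda>u v. word_rel R `` {u @ v})"
  proof (rule congruent2I')
    fix u u' v v' :: "'a word"
    assume "(u, u') \<in> word_rel R" "(v, v') \<in> word_rel R"
    then have "(u @ v, u' @ v') \<in> word_rel R"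
      by (auto simp: word_rel_def intro: word_eq_append)
    then show "word_rel R `` {u @ v} = word_rel R `` {u' @ v'}"
      by (rule equiv_class_eq [OF equiv_word_rel])
  qed
  then have "(\<Union>x\<in>word_rel R `` {u}. \<Union>y\<in>word_rel R `` {v}. word_rel R `` {x @ y}) =
      word_rel R `` {u @ v}"
    by (rule UN_equiv_class2 [OF equiv_word_rel equiv_word_rel]) simp_all
  then show ?thesis
    by (simp add: presented_group_def)
qed

lemma group_presented_group: "group (presented_group R)"
proof (rule groupI)
  note [simp] = mult_presented_group
  have carrier: "U \<in> carrier (presented_group R) \<longleftrightarrow> (\<exists>u. U = word_rel R `` {u})" for U
    by (auto simp: presented_group_def quotient_def)
  have one: "\<one>\<^bsub>presented_group R\<^esub> = word_rel R `` {[]}"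
    by (simp add: presented_group_def)
  show "\<one>\<^bsub>presented_group R\<^esub> \<in> carrier (presented_group R)"
    unfolding carrier one by (rule exI) (rule refl)
  show "U \<otimes>\<^bsub>presented_group R\<^esub> V \<in> carrier (presented_group R)"
    if "U \<in> carrier (presented_group R)" "V \<in> carrier (presented_group R)" for U V
    using that by (auto simp: carrier)
  show "U \<otimes>\<^bsub>presented_group R\<^esub> V \<otimes>\<^bsub>presented_group R\<^esub> W =
      U \<otimes>\<^bsub>presented_group R\<^esub> (V \<otimes>\<^bsub>presented_group R\<^esub> W)"
    if "U \<in> carrier (presented_group R)" "V \<in> carrier (presented_group R)"
      "W \<in> carrier (presented_group R)" for U V W
    using that by (auto simp: carrier)
  show "\<one>\<^bsub>presented_group R\<^esub> \<otimes>\<^bsub>presented_group R\<^esub> U = U"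
    if "U \<in> carrier (presented_group R)" for U
    using that by (auto simp: carrier one)
  have inverse: "\<exists>v. word_eq R (v @ u) []" for u :: "'a word"
  proof (induction u)
    case Nil
    have "word_eq R ([] @ []) []" by (simp add: word_eq_refl)
    then show ?case ..
  next
    case (Cons l u)
    then obtain v where v: "word_eq R (v @ u) []" ..
    obtain l' where l': "word_eq R [l', l] []"
      by (cases l) (auto intro: that word_eq_left_inv word_eq_right_inv)
    have "word_eq R ((v @ [l', l]) @ u) ((v @ []) @ u)"
      by (intro word_eq_append word_eq_refl l')
    then have "word_eq R ((v @ [l']) @ l # u) (v @ u)"
      by simp
    from this v have "word_eq R ((v @ [l']) @ l # u) []"
      by (rule word_eq_trans)
    then show ?case ..
  qed
  show "\<exists>V\<in>carrier (presented_group R). V \<otimes>\<^bsub>presented_group R\<^esub> U = \<one>\<^bsub>presented_group R\<^esub>"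
    if U: "U \<in> carrier (presented_group R)" for U
  proof -
    obtain u where u: "U = word_rel R `` {u}"
      using U unfolding carrier ..
    obtain v where "word_eq R (v @ u) []"
      using inverse ..
    then have "(v @ u, []) \<in> word_rel R"
      by (simp add: word_rel_def)
    then have "word_rel R `` {v} \<otimes>\<^bsub>presented_group R\<^esub> U = \<one>\<^bsub>presented_group R\<^esub>"
      unfolding u one mult_presented_group by (rule equiv_class_eq [OF equiv_word_rel])
    moreover have "word_rel R `` {v} \<in> carrier (presented_group R)"
      unfolding carrier by (rule exI) (rule refl)
    ultimately show ?thesis ..
  qed
qed

datatype gen_ab = a | b

text \<open>\<open>\<langle>a, b | a\<^bsup>2^\<alpha>\<^esup> = b\<^sup>3 = 1, b\<^sup>a = b\<^sup>-\<^sup>1\<rangle>\<close>, where \<open>b\<^sup>a = a\<^sup>-\<^sup>1 b a\<close>.\<close>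

definition G1_group :: "nat \<Rightarrow> gen_ab word set monoid"
  where "G1_group \<alpha> = presented_group
    {(replicate (2 ^ \<alpha>) (Gen a), []),
     (replicate 3 (Gen b), []),
     ([GenInv a, Gen b, Gen a], [GenInv b])}"

hide_const (open) a b

end

theory Submission
  imports Defs "HOL-Computational_Algebra.Primes"
begin

text \<open>Write \<open>f n\<close> for the value of \<open>\<psi>\<close> on the cyclic group of order \<open>n\<close> (\<open>psi_cyc n\<close> in the formal text), let \<open>n = 2\<^sup>\<alpha> m\<close> be
  the order of \<open>G\<close>, and let \<open>p\<close> be the largest prime divisor of \<open>n\<close>. Since \<open>f\<close> is multiplicative,
  \<open>f n\<close> is at least \<open>n\<^sup>2\<close> times the product of \<open>q / (q + 1)\<close> over the primes \<open>q\<close> dividing \<open>n\<close>. Hence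
  if \<open>\<psi>(G)\<close> exceeds \<open>4/7 f n\<close>, some cyclic subgroup \<open>\<langle>x\<rangle>\<close> has small index; for odd \<open>p\<close> the index is
  less than \<open>p\<close> (for \<open>p = 3\<close> index \<open>3\<close> needs the sharp constant). By a pigeonhole argument all
  elements of \<open>p\<close>-power order then lie in \<open>\<langle>x\<rangle>\<close>, so the Sylow \<open>p\<close>-subgroup \<open>P\<close> is cyclic and normal.
  Summing orders over cosets gives \<open>\<psi>(G) \<le> \<psi>(P) \<psi>(G/P)\<close>, and induction applies when \<open>G/P\<close> is not
  cyclic. When \<open>G/P\<close> is cyclic, \<open>P\<close> is not central, the cosets that do not centralize \<open>P\<close> contribute
  much less, and the resulting bound is exactly the one attained by \<open>G\<^sub>1\<close>. The remaining groups are
  \<open>2\<close>-groups with a cyclic subgroup of index \<open>2\<close>; for \<open>\<alpha> = 2, 3\<close> they give the exceptional bounds.\<close>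


section \<open>The order sum of a cyclic group\<close>

text \<open>The constant 4/7 is the limit, for growing \<alpha>, of the ratio attained by
  \<open>G\<^sub>1\<close>. That ratio stays above 4/7, so one threshold serves every \<alpha> when
  a large cyclic subgroup is sought. The formula for \<open>G\<^sub>1\<close> combines two extreme
  cases: 7|P| \<le> 3 \<psi>(P), with equality for |P| = 3, and f(N/l)/f(N), which over the primes l
  dividing N is at most its value for l = 2. Its value for \<alpha> = 1 is 13/21, since
  \<open>G\<^sub>1\<close> is then \<open>S\<^sub>3\<close>. For \<alpha> = 2, 3 it is beaten by
  noncyclic 2-groups. In these two cases it suffices to give every element outside a cyclic subgroup
  of index 2 the order of that subgroup. From \<alpha> = 4 on this count would exceed the bound,
  which is why the action on the cyclic subgroup has to be examined there.\<close>

definition psi_cyc :: "nat \<Rightarrow> nat"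
  where "psi_cyc n = (\<Sum>i<n. n div gcd i n)"

lemma psi_cyc_1 [simp]: "psi_cyc (Suc 0) = 1"
  by (simp add: psi_cyc_def)

lemma psi_cyc_pos: "0 < n \<Longrightarrow> 0 < psi_cyc n"
  unfolding psi_cyc_def
  by (rule sum_pos) (simp_all add: div_greater_zero_iff gcd_le2_nat lessThan_empty_iff)

text \<open>The indices are split by divisibility by \<open>p\<close>. The multiples
  \<open>p * j\<close> reproduce the sum for \<open>p ^ k\<close>, because a factor \<open>p\<close>
  cancels; every other index is prime to \<open>p\<close> and contributes the full
  \<open>p ^ Suc k\<close>.\<close>

lemma psi_cyc_prime_power_Suc:
  assumes "prime p"
  shows "psi_cyc (p ^ Suc k) = psi_cyc (p ^ k) + p ^ Suc k * (p ^ Suc k - p ^ k)"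
proof -
  have p0: "p > 0" using assms by (simp add: prime_gt_0_nat)
  let ?A = "{..<p ^ Suc k}" and ?B = "(\<lambda>j. p * j) ` {..<p ^ k}"
  have sub: "?B \<subseteq> ?A" using p0 by auto
  have B: "(\<Sum>i\<in>?B. p ^ Suc k div gcd i (p ^ Suc k)) = psi_cyc (p ^ k)"
    unfolding psi_cyc_def using p0
    by (subst sum.reindex) (auto simp: inj_on_def gcd_mult_distrib_nat[symmetric] intro!: sum.cong)
  have cardB: "card ?B = p ^ k"
    using p0 by (subst card_image) (auto simp: inj_on_def)
  have "(\<Sum>i\<in>?A - ?B. p ^ Suc k div gcd i (p ^ Suc k)) = (\<Sum>i\<in>?A - ?B. p ^ Suc k)"
  proof (rule sum.cong [OF refl])
    fix i assume i: "i \<in> ?A - ?B"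
    have "\<not> p dvd i"
    proof
      assume "p dvd i"
      then obtain j where "i = p * j" ..
      with i p0 show False by auto
    qed
    then have "coprime i (p ^ Suc k)"
      using assms prime_imp_coprime coprime_commute by (metis coprime_power_right_iff)
    then show "p ^ Suc k div gcd i (p ^ Suc k) = p ^ Suc k" by simp
  qed
  also have "\<dots> = p ^ Suc k * (p ^ Suc k - p ^ k)"
    using cardB sub by (simp add: card_Diff_subset finite_subset[OF sub])
  finally show ?thesis
    using B sum.subset_diff[OF sub, of "\<lambda>i. p ^ Suc k div gcd i (p ^ Suc k)"]
    unfolding psi_cyc_def[of "p ^ Suc k"] by simp
qed

text \<open>Multiplication by \<open>p + 1\<close> clears the denominator of the closed form, so
  that it can be stated on the naturals.\<close>

lemma psi_cyc_prime_power:
  assumes "prime p"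
  shows "(p + 1) * psi_cyc (p ^ k) = p ^ (2 * k + 1) + 1"
proof (induction k)
  case 0
  show ?case by simp
next
  case (Suc k)
  have le: "p ^ k \<le> p ^ Suc k" using prime_gt_0_nat[OF assms] by simp
  \<comment> \<open>The computation moves to the integers because \<open>p ^ Suc k - p ^ k\<close>
    is a truncated subtraction.\<close>
  have "int ((p + 1) * psi_cyc (p ^ Suc k)) =
      int ((p + 1) * psi_cyc (p ^ k)) + int ((p + 1) * (p ^ Suc k * (p ^ Suc k - p ^ k)))"
    unfolding psi_cyc_prime_power_Suc[OF assms] by (simp only: distrib_left of_nat_add)
  also have "\<dots> = int (p ^ (2 * k + 1) + 1) + int ((p + 1) * (p ^ Suc k * (p ^ Suc k - p ^ k)))"
    unfolding Suc.IH ..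
  also have "\<dots> = int (p ^ (2 * Suc k + 1) + 1)"
  proof -
    have pow: "p ^ (2 * k + 1) = p * (p ^ k * p ^ k)" "p ^ (2 * Suc k + 1) = p * (p * (p * (p ^ k * p ^ k)))"
      by (simp_all add: mult_2 power_add)
    have diff: "int (p ^ Suc k - p ^ k) = int p * int (p ^ k) - int (p ^ k)"
      using le by (simp add: of_nat_diff)
    show ?thesis
      unfolding pow of_nat_add of_nat_mult diff unfolding power_Suc by (simp add: algebra_simps)
  qed
  finally show ?case by linarith
qed

text \<open>Chinese remainder theorem: the pair of residues determines the index, surjectivity
  follows by counting, and gcd(i, xy) = gcd(i, x) gcd(i, y) turns the summand into a
  product.\<close>

lemma psi_cyc_mult:
  assumes "coprime x y"
  shows "psi_cyc (x * y) = psi_cyc x * psi_cyc y"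
proof (cases "x = 0 \<or> y = 0")
  case True
  then show ?thesis by (auto simp: psi_cyc_def)
next
  case False
  then have pos: "x > 0" "y > 0" by auto
  let ?f = "\<lambda>i. (i mod x, i mod y)"
  have inj: "inj_on ?f {..<x * y}"
  proof (rule inj_onI)
    fix i j assume ij: "i \<in> {..<x * y}" "j \<in> {..<x * y}" "?f i = ?f j"
    then have "int i mod int x = int j mod int x" "int i mod int y = int j mod int y"
      by (auto simp flip: zmod_int)
    then have "int (x * y) dvd int i - int j"
      using assms by (auto simp: mod_eq_dvd_iff intro: divides_mult)
    then have "int i mod int (x * y) = int j mod int (x * y)"
      by (simp only: mod_eq_dvd_iff)
    then have "i mod (x * y) = j mod (x * y)"
      by (metis of_nat_eq_iff zmod_int)
    with ij show "i = j" by simp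
  qed
  have "?f ` {..<x * y} = {..<x} \<times> {..<y}"
    using pos by (intro card_subset_eq) (auto simp: card_image[OF inj])
  with inj have bij: "bij_betw ?f {..<x * y} ({..<x} \<times> {..<y})"
    by (simp add: bij_betw_def)
  have gcd: "x * y div gcd i (x * y) = (x div gcd (i mod x) x) * (y div gcd (i mod y) y)" for i
  proof -
    have "gcd i (x * y) = gcd i x * gcd i y"
    proof (rule dvd_antisym)
      have "coprime (gcd i x) (gcd i y)"
        using assms coprime_divisors[of "gcd i x" x "gcd i y" y] by simp
      then show "gcd i x * gcd i y dvd gcd i (x * y)"
        by (simp add: divides_mult mult_dvd_mono)
      obtain u v where "gcd i (x * y) = u * v" "u dvd x" "v dvd y"
        using division_decomp[of "gcd i (x * y)" x y] by auto
      moreover from this have "u dvd i" "v dvd i"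
        by (metis dvd_mult_left dvd_mult_right gcd_dvd1)+
      ultimately show "gcd i (x * y) dvd gcd i x * gcd i y"
        by (simp add: mult_dvd_mono)
    qed
    then show ?thesis
      by (simp add: gcd.commute div_mult_div_if_dvd flip: gcd_red_nat)
  qed
  have "psi_cyc (x * y) = (\<Sum>i<x * y. case ?f i of (i, j) \<Rightarrow> (x div gcd i x) * (y div gcd j y))"
    unfolding psi_cyc_def by (simp add: gcd)
  also have "\<dots> = (\<Sum>(i, j)\<in>{..<x} \<times> {..<y}. (x div gcd i x) * (y div gcd j y))"
    by (rule sum.reindex_bij_betw[OF bij])
  also have "\<dots> = psi_cyc x * psi_cyc y"
    by (simp add: psi_cyc_def sum_product sum.cartesian_product)
  finally show ?thesis .
qed

lemma psi_cyc_prod_prime_powers: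
  fixes k :: "nat \<Rightarrow> nat"
  assumes "finite A" "\<And>p. p \<in> A \<Longrightarrow> prime p"
  shows "psi_cyc (\<Prod>p\<in>A. p ^ k p) = (\<Prod>p\<in>A. psi_cyc (p ^ k p))"
  using assms
proof (induction A rule: finite_induct)
  case (insert p A)
  have "coprime (p ^ k p) (\<Prod>q\<in>A. q ^ k q)"
    using insert.prems insert.hyps
    by (intro prod_coprime_right) (auto intro!: primes_coprime)
  then show ?case using insert by (simp add: psi_cyc_mult)
qed simp

text \<open>The closed form for a prime power is q^2 p / (p + 1) plus 1 / (p + 1), where q is that
  power; the second term is dropped.\<close>

lemma psi_cyc_ge_prod:
  assumes "n > 0"
  shows "real n ^ 2 * (\<Prod>p\<in>prime_factors n. real p / (real p + 1)) \<le> real (psi_cyc n)"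
proof -
  have n: "n = (\<Prod>p\<in>prime_factors n. p ^ multiplicity p n)"
    using assms by (rule prime_factorization_nat)
  have "real n ^ 2 * (\<Prod>p\<in>prime_factors n. real p / (real p + 1)) =
      (\<Prod>p\<in>prime_factors n. real (p ^ multiplicity p n) ^ 2 * (real p / (real p + 1)))"
    by (subst (1) n) (simp only: of_nat_prod prod.distrib prod_power_distrib)
  also have "\<dots> \<le> (\<Prod>p\<in>prime_factors n. real (psi_cyc (p ^ multiplicity p n)))"
  proof (rule prod_mono, safe)
    fix p assume "p \<in> prime_factors n"
    then have "prime p" by auto
    from arg_cong[OF psi_cyc_prime_power[OF this, of "multiplicity p n"], of real]
    have "(real p + 1) * real (psi_cyc (p ^ multiplicity p n)) = real p * real (p ^ multiplicity p n) ^ 2 + 1"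
      by (simp add: mult_2 power_add power2_eq_square del: distrib_right_numeral ring_distribs) (simp add: algebra_simps)
    then show "real (p ^ multiplicity p n) ^ 2 * (real p / (real p + 1)) \<le> real (psi_cyc (p ^ multiplicity p n))"
      by (simp add: field_simps)
  qed auto
  also have "\<dots> = real (psi_cyc (\<Prod>p\<in>prime_factors n. p ^ multiplicity p n))"
    by (subst psi_cyc_prod_prime_powers) (auto simp: in_prime_factors_imp_prime)
  also have "\<dots> = real (psi_cyc n)"
    by (simp only: n[symmetric])
  finally show ?thesis .
qed

text \<open>All integers from 5 to \<open>p\<close> stand in for the primes in that range, so that
  the product of q / (q + 1) telescopes to 5 / (p + 1); the primes 2 and 3 contribute 1/2. Leaving
  out 4 matters: with it the product would be only 2 / (p + 1), too small for \<open>p = 5\<close>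
  in the search for a subgroup of small index.\<close>

lemma psi_cyc_ge_largest_prime:
  assumes "n > 0" "prime_factors n \<subseteq> {..p}" "p \<ge> 5"
  shows "5 * real n ^ 2 \<le> 2 * (real p + 1) * real (psi_cyc n)"
proof -
  let ?g = "\<lambda>q::nat. real q / (real q + 1)"
  let ?S = "{2, 3} \<union> {5..p}"
  have sub: "prime_factors n \<subseteq> ?S"
  proof
    fix q assume q: "q \<in> prime_factors n"
    then have "prime q" "q \<le> p" using assms by auto
    moreover have "q \<noteq> 4" "q \<ge> 2" using \<open>prime q\<close> by (auto simp: prime_ge_2_nat)
    ultimately show "q \<in> ?S" by force
  qed
  have "(\<Prod>q\<in>{5..p}. ?g q) = 5 / (real p + 1)"
    using assms(3)
    by (induction p rule: dec_induct) (auto simp: field_simps)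
  then have S: "(\<Prod>q\<in>?S. ?g q) = 5 / (2 * (real p + 1))"
    by (subst prod.union_disjoint) (auto simp: field_simps)
  have "(\<Prod>q\<in>?S. ?g q) = (\<Prod>q\<in>?S - prime_factors n. ?g q) * (\<Prod>q\<in>prime_factors n. ?g q)"
    using sub by (intro prod.subset_diff) auto
  also have "\<dots> \<le> 1 * (\<Prod>q\<in>prime_factors n. ?g q)"
    by (intro mult_right_mono prod_le_1 prod_nonneg) (auto simp: divide_simps)
  finally have "real n ^ 2 * (5 / (2 * (real p + 1))) \<le> real n ^ 2 * (\<Prod>q\<in>prime_factors n. ?g q)"
    unfolding S by (intro mult_left_mono) auto
  also have "\<dots> \<le> real (psi_cyc n)"
    using assms(1) by (rule psi_cyc_ge_prod)
  finally show ?thesis by (simp add: field_simps)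
qed

text \<open>Dividing by \<open>l\<close> changes only the \<open>l\<close>-part of \<open>N\<close>
  and multiplies the value by (l^(2j+1) + 1) / (l^(2j+3) + 1). For \<open>l = 2\<close> the claim is
  an equality; for odd \<open>l\<close> the factor l^2 \<ge> 9 leaves enough room.\<close>

lemma psi_cyc_div_prime:
  assumes "prime l" "l dvd N" "N = 2 ^ \<alpha> * m" "odd m" "\<alpha> \<ge> 1"
  shows "(2 ^ (2 * \<alpha> + 1) + 1) * psi_cyc (N div l) \<le> (2 ^ (2 * \<alpha> - 1) + 1) * psi_cyc N"
proof -
  have N0: "N > 0" using assms(3) odd_pos[OF assms(4)] by simp
  define k where "k = multiplicity l N"
  obtain M where M: "N = l ^ k * M" and lM: "\<not> l dvd M"
    using multiplicity_decompose'[of N l] N0 assms(1) unfolding k_def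
    by (metis not_prime_unit less_numeral_extra(3) prime_gt_0_nat)
  have "k > 0" using prime_multiplicity_gt_zero_iff[OF prime_imp_prime_elem[OF assms(1)], of N] N0 assms(2)
    unfolding k_def by blast
  then obtain j where j: "k = Suc j" by (cases k) auto
  have cop: "coprime (l ^ i) M" for i using prime_imp_coprime[OF assms(1) lM] by simp
  have Nd: "N div l = l ^ j * M" using M j assms(1) by (simp add: prime_gt_0_nat)
  have fN: "psi_cyc N = psi_cyc (l ^ Suc j) * psi_cyc M" using M psi_cyc_mult[OF cop[of k]] j by simp
  have fd: "psi_cyc (N div l) = psi_cyc (l ^ j) * psi_cyc M" using Nd psi_cyc_mult[OF cop] by simp
  have e1: "(l + 1) * psi_cyc (l ^ Suc j) = l ^ (2 * j + 3) + 1"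
    using psi_cyc_prime_power[OF assms(1), of "Suc j"] by (simp add: numeral_3_eq_3)
  have e2: "(l + 1) * psi_cyc (l ^ j) = l ^ (2 * j + 1) + 1"
    by (rule psi_cyc_prime_power[OF assms(1)])
  have key: "(2 ^ (2 * \<alpha> + 1) + 1) * (l ^ (2 * j + 1) + 1) \<le> (2 ^ (2 * \<alpha> - 1) + 1) * (l ^ (2 * j + 3) + 1)"
  proof (cases "l = 2")
    case True
    have "\<alpha> = k"
      unfolding k_def True assms(3) using assms(4)
      by (intro multiplicity_eqI[symmetric]) auto
    with True j show ?thesis by (simp add: numeral_3_eq_3)
  next
    case False
    with assms(1) have "l \<ge> 3" using prime_ge_2_nat[of l] by linarith
    then have "3 ^ 2 \<le> l ^ 2" by (intro power_mono) auto
    then have 9: "9 * l ^ (2 * j + 1) \<le> l ^ (2 * j + 3)"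
      by (simp add: numeral_3_eq_3 power2_eq_square)
    have one: "l ^ (2 * j + 1) \<ge> 1" "(2::nat) ^ (2 * \<alpha> - 1) \<ge> 1"
      using prime_gt_0_nat[OF assms(1)] by (simp_all add: Suc_le_eq)
    have a4: "(2::nat) ^ (2 * \<alpha> + 1) = 4 * 2 ^ (2 * \<alpha> - 1)"
      using assms(5) by (cases \<alpha>) auto
    have "(4 * u + 1) * (v + 1) \<le> (u + 1) * (9 * v + 1)" if "u \<ge> 1" "v \<ge> 1" for u v :: nat
    proof -
      have "u * 1 \<le> u * v" using that by (intro mult_left_mono) auto
      then have "4 * (u * v) + 4 * u + v + 1 \<le> 9 * (u * v) + u + 9 * v + 1"
        using that by linarith
      then show ?thesis by (simp add: distrib_left distrib_right)
    qed
    from this[OF one(2) one(1)] have "(2 ^ (2 * \<alpha> + 1) + 1) * (l ^ (2 * j + 1) + 1) \<le>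
       (2 ^ (2 * \<alpha> - 1) + 1) * (9 * l ^ (2 * j + 1) + 1)" unfolding a4 .
    also have "\<dots> \<le> (2 ^ (2 * \<alpha> - 1) + 1) * (l ^ (2 * j + 3) + 1)"
      using 9 by (intro mult_left_mono) auto
    finally show ?thesis .
  qed
  have "(l + 1) * ((2 ^ (2 * \<alpha> + 1) + 1) * psi_cyc (l ^ j)) \<le> (l + 1) * ((2 ^ (2 * \<alpha> - 1) + 1) * psi_cyc (l ^ Suc j))"
    using key unfolding e1[symmetric] e2[symmetric] by (simp only: mult.left_commute)
  then have "(2 ^ (2 * \<alpha> + 1) + 1) * psi_cyc (l ^ j) \<le> (2 ^ (2 * \<alpha> - 1) + 1) * psi_cyc (l ^ Suc j)"
    by (rule mult_left_le_imp_le) simp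
  then show ?thesis unfolding fN fd mult.assoc[symmetric] by (rule mult_le_mono1)
qed

section \<open>Order sums of finite groups\<close>

context group
begin

lemma finite_ord_pos: "finite (carrier G) \<Longrightarrow> x \<in> carrier G \<Longrightarrow> 0 < ord x"
  using ord_ge_1[of x] by simp

lemma inj_on_pow_ord: "x \<in> carrier G \<Longrightarrow> inj_on (\<lambda>i::nat. x [^] i) {..<ord x}"
  using ord_inj[of x] by (rule inj_on_subset) auto

lemma pow_mod_ord: "x \<in> carrier G \<Longrightarrow> x [^] (i mod ord x) = x [^] i"
  by (metis int_pow_eq int_pow_int mod_eq_dvd_iff mod_mod_trivial zmod_int dvd_refl)

lemma nat_pow_two: "x \<in> carrier G \<Longrightarrow> x [^] (2::nat) = x \<otimes> x"
  by (simp add: numeral_2_eq_2)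

lemma nat_pow_eq_iff:
  assumes "x \<in> carrier G"
  shows "x [^] (i::nat) = x [^] (j::nat) \<longleftrightarrow> int (ord x) dvd int i - int j"
  using int_pow_eq[OF assms, of "int j" "int i"] by (auto simp: int_pow_int)

lemma ex_nat_pow_eq_int_pow:
  assumes "finite (carrier G)" "x \<in> carrier G"
  shows "\<exists>k::nat. x [^] (i::int) = x [^] k"
proof
  have "x [^] nat (i mod int (ord x)) = x [^] (i mod int (ord x))"
    using finite_ord_pos[OF assms] by (simp flip: int_pow_int)
  then show "x [^] i = x [^] nat (i mod int (ord x))"
    using int_pow_eq[OF assms(2), of "i mod int (ord x)" i] by (simp add: minus_mod_eq_mult_div)
qed

text \<open>The bridge from arithmetic to groups: \<open>x [^] i\<close> has order
  \<open>ord x div gcd i (ord x)\<close>.\<close>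

lemma sum_ord_pow:
  assumes "x \<in> carrier G"
  shows "(\<Sum>i<ord x. ord (x [^] i)) = psi_cyc (ord x)"
  unfolding psi_cyc_def using assms
  by (intro sum.cong) (auto simp: ord_pow_gen gcd.commute)

lemma sum_ord_pow_image:
  assumes "x \<in> carrier G"
  shows "(\<Sum>y\<in>(\<lambda>i::nat. x [^] i) ` {..<ord x}. ord y) = psi_cyc (ord x)"
  using sum_ord_pow[OF assms] by (simp add: sum.reindex[OF inj_on_pow_ord[OF assms]])

lemma carrier_eq_pow_image:
  assumes "finite (carrier G)" "x \<in> carrier G" "ord x = order G"
  shows "carrier G = (\<lambda>i::nat. x [^] i) ` {..<ord x}"
proof (rule card_subset_eq[symmetric])
  show "card ((\<lambda>i::nat. x [^] i) ` {..<ord x}) = card (carrier G)"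
    using card_image[OF inj_on_pow_ord[OF assms(2)]] assms(3) by (simp add: order_def)
qed (use assms in auto)

lemma cyclic_group_iff_ord:
  assumes "finite (carrier G)"
  shows "cyclic_group G \<longleftrightarrow> (\<exists>x\<in>carrier G. ord x = order G)"
proof
  assume "cyclic_group G"
  then obtain x where "x \<in> carrier G" "subgroup_generated G {x} = G"
    unfolding cyclic_group_def by auto
  then show "\<exists>x\<in>carrier G. ord x = order G"
    using cyclic_order_is_ord[of x] by auto
next
  assume "\<exists>x\<in>carrier G. ord x = order G"
  then obtain x where x: "x \<in> carrier G" "ord x = order G" by auto
  have "carrier G = range (\<lambda>n::int. x [^] n)"
  proof
    show "carrier G \<subseteq> range (\<lambda>n::int. x [^] n)"
      unfolding carrier_eq_pow_image[OF assms x] by (auto simp flip: int_pow_int)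
  qed (use x in auto)
  with x(1) show "cyclic_group G" unfolding cyclic_group by blast
qed

lemma psi_cyclic_group:
  assumes "finite (carrier G)" "cyclic_group G"
  shows "psi G = psi_cyc (order G)"
proof -
  obtain x where x: "x \<in> carrier G" "ord x = order G"
    using assms cyclic_group_iff_ord by auto
  show ?thesis
    using sum_ord_pow_image[OF x(1)] arg_cong[OF carrier_eq_pow_image[OF assms(1) x], of "sum ord"] x(2)
    by (simp add: psi_def)
qed

text \<open>Raising u v to the power o(uv) o(v) removes v and leaves a power of u, so o(u) divides
  o(uv) o(v), and by coprimality o(uv). By symmetry o(v) divides it too.\<close>

lemma ord_dvd_order_of_commuting_mult:
  assumes "x \<in> carrier G" "y \<in> carrier G" "x \<otimes> y = y \<otimes> x" "coprime (ord x) (ord y)"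
  shows "ord (x \<otimes> y) = ord x * ord y"
proof (rule dvd_antisym)
  show "ord (x \<otimes> y) dvd ord x * ord y"
    using assms by (intro ord_mul_divides)
  have *: "ord u dvd ord (u \<otimes> v)"
    if "u \<in> carrier G" "v \<in> carrier G" "u \<otimes> v = v \<otimes> u" "coprime (ord u) (ord v)" for u v
  proof -
    have "(u \<otimes> v) [^] (ord (u \<otimes> v) * ord v) = \<one>"
      using that by (metis m_closed nat_pow_one nat_pow_pow pow_ord_eq_1)
    then have "u [^] (ord (u \<otimes> v) * ord v) \<otimes> v [^] (ord v * ord (u \<otimes> v)) = \<one>"
      using that pow_mult_distrib[of u v] by (simp add: mult.commute[of "ord v"])
    then have "u [^] (ord (u \<otimes> v) * ord v) = \<one>"
      using that by (simp flip: nat_pow_pow)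
    then have "ord u dvd ord (u \<otimes> v) * ord v"
      using that pow_eq_id by simp
    then show ?thesis
      using that(4) coprime_dvd_mult_left_iff by blast
  qed
  show "ord x * ord y dvd ord (x \<otimes> y)"
    using *[OF assms] *[of y x] assms by (metis coprime_commute divides_mult)
qed

lemma psi_eq_powers_plus_rest:
  assumes "finite (carrier G)" "x \<in> carrier G"
  shows "psi G = psi_cyc (ord x) + (\<Sum>y\<in>carrier G - (\<lambda>i::nat. x [^] i) ` {..<ord x}. ord y)"
proof -
  have "(\<lambda>i::nat. x [^] i) ` {..<ord x} \<subseteq> carrier G" using assms by auto
  from sum.subset_diff[OF this assms(1), of ord] show ?thesis
    unfolding psi_def sum_ord_pow_image[OF assms(2)] by simp
qed

lemma card_diff_powers:
  assumes "finite (carrier G)" "x \<in> carrier G"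
  shows "card (carrier G - (\<lambda>i::nat. x [^] i) ` {..<ord x}) = order G - ord x"
  using assms by (subst card_Diff_subset) (auto simp: order_def card_image inj_on_pow_ord)

text \<open>The powers of \<open>x\<close> are counted exactly and only the complement by
  \<open>M\<close>. This gain over \<open>order G * M\<close> is what settles index 3 and the
  2-groups of order 4 and 8.\<close>

lemma psi_le_of_ord_bound:
  assumes "finite (carrier G)" "x \<in> carrier G" "\<And>y. y \<in> carrier G \<Longrightarrow> ord y \<le> M"
  shows "psi G \<le> psi_cyc (ord x) + (order G - ord x) * M"
  unfolding psi_eq_powers_plus_rest[OF assms(1,2)]
  using assms sum_bounded_above[of "carrier G - (\<lambda>i::nat. x [^] i) ` {..<ord x}" ord M]
  by (simp add: card_diff_powers)

end

lemma psi_integer_mod_group: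
  assumes "n > 0"
  shows "psi (integer_mod_group n) = psi_cyc n"
proof -
  interpret group "integer_mod_group n" by simp
  have fin: "finite (carrier (integer_mod_group n))"
    and order: "order (integer_mod_group n) = n"
    using assms by (simp_all add: carrier_integer_mod_group order_def)
  \<comment> \<open>The generator is \<open>1 mod int n\<close> because for \<open>n = 1\<close> the
    carrier consists of 0 alone.\<close>
  have mem: "1 mod int n \<in> carrier (integer_mod_group n)"
    using assms by (simp add: carrier_integer_mod_group)
  have "ord (1 mod int n) = n"
    unfolding ord_unique[OF mem]
    by (simp add: mod_mult_right_eq flip: zmod_int mod_eq_0_iff_dvd)
  then have "cyclic_group (integer_mod_group n)"
    using cyclic_group_iff_ord[OF fin] mem order by auto
  then show ?thesis
    using psi_cyclic_group[OF fin] order by simp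
qed

lemma ord_iso:
  assumes "h \<in> iso G H" "group G" "group H" "x \<in> carrier G"
  shows "group.ord H (h x) = group.ord G x"
proof -
  have h: "h \<in> hom G H" "inj_on h (carrier G)" using assms by (auto simp: iso_def bij_betw_def)
  have hx: "h x \<in> carrier H" using h assms(4) by (auto simp: hom_def)
  show ?thesis
  proof (subst group.ord_unique[OF assms(3) hx], intro allI)
    fix n :: nat
    have "h (x [^]\<^bsub>G\<^esub> n) = h x [^]\<^bsub>H\<^esub> n"
      using hom_nat_pow[OF h(1) assms(4,2,3)] .
    moreover have "h \<one>\<^bsub>G\<^esub> = \<one>\<^bsub>H\<^esub>"
      using hom_one[OF h(1) assms(2,3)] .
    ultimately have "h x [^]\<^bsub>H\<^esub> n = \<one>\<^bsub>H\<^esub> \<longleftrightarrow> h (x [^]\<^bsub>G\<^esub> n) = h \<one>\<^bsub>G\<^esub>"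
      by simp
    also have "\<dots> \<longleftrightarrow> x [^]\<^bsub>G\<^esub> n = \<one>\<^bsub>G\<^esub>"
      by (rule inj_on_eq_iff[OF h(2)]) (simp_all add: assms group.is_monoid monoid.nat_pow_closed monoid.one_closed)
    also have "\<dots> \<longleftrightarrow> group.ord G x dvd n"
      using group.pow_eq_id[OF assms(2,4)] .
    finally show "h x [^]\<^bsub>H\<^esub> n = \<one>\<^bsub>H\<^esub> \<longleftrightarrow> group.ord G x dvd n" .
  qed
qed

lemma psi_iso:
  assumes "G \<cong> H" "group G" "group H"
  shows "psi G = psi H"
proof -
  obtain h where h: "h \<in> iso G H" using assms(1) by (auto simp: is_iso_def)
  then have "bij_betw h (carrier G) (carrier H)" by (simp add: iso_def)
  from sum.reindex_bij_betw[OF this, of "group.ord H"] show ?thesis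
    unfolding psi_def using ord_iso[OF h assms(2,3)] by simp
qed

text \<open>A quotient group has sets as elements, so an induction over groups of one type cannot
  descend to it directly. Replacing each finite group by a copy on \<open>nat\<close> keeps the type
  fixed.\<close>

lemma finite_group_iso_nat:
  assumes "group G" "finite (carrier G)"
  obtains H :: "nat monoid" where "group H" "G \<cong> H"
proof -
  interpret group G by fact
  obtain h where h: "bij_betw h (carrier G) {0..<card (carrier G)}"
    using ex_bij_betw_finite_nat[OF assms(2)] by auto
  define g where "g = the_inv_into (carrier G) h"
  have gh: "g (h x) = x" if "x \<in> carrier G" for x
    using h that by (simp add: g_def bij_betw_def the_inv_into_f_f)
  define K :: "nat monoid" where
    "K = \<lparr>carrier = h ` carrier G, monoid.mult = \<lambda>i j. h (g i \<otimes>\<^bsub>G\<^esub> g j), one = h \<one>\<^bsub>G\<^esub>\<rparr>"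
  have hom: "h \<in> hom G K" by (auto simp: hom_def K_def gh)
  then have "group K"
    using hom_imp_img_group[OF hom] by (simp add: K_def)
  moreover have "h \<in> iso G K"
    using hom h by (auto simp: iso_def K_def bij_betw_def)
  ultimately show ?thesis using that is_isoI by blast
qed

section \<open>Groups with a unique cyclic Sylow subgroup\<close>

text \<open>The cyclic Sylow subgroup and its uniqueness are expressed by an equation: all solutions
  of \<open>u [^] (p ^ s) = \<one>\<close> are powers of \<open>w\<close>. Conjugation maps such
  solutions to solutions, which makes normality immediate.\<close>

locale unique_cyclic_sylow = group G for G (structure) +
  fixes w p s N
  assumes fin: "finite (carrier G)"
    and p: "prime p"
    and w: "w \<in> carrier G" "ord w = p ^ s"
    and order: "order G = p ^ s * N"
    and N: "\<not> p dvd N"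
    and unique: "\<And>u. u \<in> carrier G \<Longrightarrow> u [^] (p ^ s) = \<one> \<Longrightarrow> \<exists>i::nat. u = w [^] i"
begin

definition P where "P = {u \<in> carrier G. u [^] (p ^ s) = \<one>}"

lemma P_eq_powers: "P = (\<lambda>i::nat. w [^] i) ` {..<p ^ s}"
proof
  show "P \<subseteq> (\<lambda>i::nat. w [^] i) ` {..<p ^ s}"
  proof
    fix u assume "u \<in> P"
    then obtain i :: nat where "u = w [^] i" using unique P_def by blast
    then have "u = w [^] (i mod p ^ s)" using pow_mod_ord[OF w(1), of i] w(2) by simp
    then show "u \<in> (\<lambda>i::nat. w [^] i) ` {..<p ^ s}" using p by (auto simp: prime_gt_0_nat)
  qed
  show "(\<lambda>i::nat. w [^] i) ` {..<p ^ s} \<subseteq> P"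
    unfolding P_def using w by (auto simp: nat_pow_pow pow_eq_id)
qed

lemma w_in_P: "w \<in> P"
  unfolding P_def using w pow_ord_eq_1[OF w(1)] by simp

lemma pow_w_in_P: "w [^] (i::nat) \<in> P"
  unfolding P_def using w by (auto simp: nat_pow_pow pow_eq_id)

lemma P_pow: "u \<in> P \<Longrightarrow> \<exists>i::nat. u = w [^] i"
  using unique P_def by blast

lemma P_nat_pow: "u \<in> P \<Longrightarrow> u [^] (i::nat) \<in> P"
  using P_pow[of u] w(1) pow_w_in_P by (auto simp: nat_pow_pow)

lemma P_commute: "u \<in> P \<Longrightarrow> v \<in> P \<Longrightarrow> u \<otimes> v = v \<otimes> u"
  using P_pow[of u] P_pow[of v] w by (auto simp: nat_pow_mult add.commute)

lemma P_closed: "u \<in> P \<Longrightarrow> u \<in> carrier G"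
  by (simp add: P_def)

lemma subgroup_P: "subgroup P G"
proof (rule subgroupI)
  show "u \<otimes> v \<in> P" if "u \<in> P" "v \<in> P" for u v
    using that P_commute[OF that] pow_mult_distrib[of u v "p ^ s"] by (auto simp: P_def)
qed (use w_in_P in \<open>auto simp: P_def nat_pow_inv\<close>)

lemma mult_inv_cancel: "x \<in> carrier G \<Longrightarrow> z \<in> carrier G \<Longrightarrow> x \<otimes> (inv x \<otimes> z) = z"
  by (simp flip: m_assoc)

lemma conj_pow:
  assumes "x \<in> carrier G" "u \<in> carrier G"
  shows "(inv x \<otimes> u \<otimes> x) [^] (i::nat) = inv x \<otimes> u [^] i \<otimes> x"
  using assms by (induction i) (simp_all add: m_assoc mult_inv_cancel)

lemma conj_in_P: "x \<in> carrier G \<Longrightarrow> u \<in> P \<Longrightarrow> inv x \<otimes> u \<otimes> x \<in> P"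
  by (simp add: P_def conj_pow)

lemma normal_P: "P \<lhd> G"
proof (rule normal_invI[OF subgroup_P])
  fix x u assume "x \<in> carrier G" "u \<in> P"
  then show "x \<otimes> u \<otimes> inv x \<in> P" using conj_in_P[of "inv x" u] by simp
qed

interpretation normal P G by (rule normal_P)

lemma card_P: "card P = p ^ s"
  unfolding P_eq_powers using card_image[OF inj_on_pow_ord[OF w(1)]] w(2) by simp

lemma sum_ord_P: "(\<Sum>u\<in>P. ord u) = psi_cyc (p ^ s)"
  unfolding P_eq_powers using sum_ord_pow_image[OF w(1)] w(2) by simp

lemma coprime_pN: "coprime (p ^ s) N"
  using prime_imp_coprime[OF p N] by simp

abbreviation Q where "Q \<equiv> G Mod P"

lemma group_Q: "group Q" by (rule factorgroup_is_group)

lemma carrier_Q: "carrier Q = rcosets P" by (simp add: FactGroup_def)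

lemma order_Q: "order Q = N"
proof -
  have "card (rcosets P) * p ^ s = N * p ^ s"
    using lagrange[OF subgroup_P] unfolding order card_P by (simp only: mult.commute)
  then show ?thesis using prime_gt_0_nat[OF p] unfolding order_def carrier_Q by simp
qed

lemma finite_Q: "finite (carrier Q)"
proof -
  have "p ^ s * N > 0" using fin order_gt_0_iff_finite unfolding order by simp
  then have "order Q > 0" unfolding order_Q by simp
  then show ?thesis unfolding order_def by (rule card_ge_0_finite)
qed

lemma mem_coset: "X \<in> carrier Q \<Longrightarrow> y \<in> X \<Longrightarrow> y \<in> carrier G \<and> X = P #> y"
proof
  assume "X \<in> carrier Q" "y \<in> X"
  then obtain x where x: "x \<in> carrier G" "X = P #> x" by (auto simp: carrier_Q RCOSETS_def)
  with \<open>y \<in> X\<close> show "y \<in> carrier G" using elemrcos_carrier[OF is_group] by simp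
  show "X = P #> y" using x \<open>y \<in> X\<close> repr_independence[of y P x] subgroup_P by simp
qed

lemma pow_coset_eq_one:
  assumes "X \<in> carrier Q" "y \<in> X"
  shows "X [^]\<^bsub>Q\<^esub> (j::nat) = \<one>\<^bsub>Q\<^esub> \<longleftrightarrow> y [^] j \<in> P"
proof -
  have y: "y \<in> carrier G" "X = P #> y" using mem_coset[OF assms] by auto
  have "X [^]\<^bsub>Q\<^esub> j = P #> (y [^] j)"
    unfolding y(2) by (rule FactGroup_pow[OF y(1)])
  then have "X [^]\<^bsub>Q\<^esub> j = \<one>\<^bsub>Q\<^esub> \<longleftrightarrow> P #> (y [^] j) = P" unfolding one_FactGroup by simp
  also have "\<dots> \<longleftrightarrow> y [^] j \<in> P"
    using coset_join1[OF _ _ subgroup_P] coset_join2[OF _ subgroup_P] nat_pow_closed[OF y(1)] by blast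
  finally show ?thesis .
qed

text \<open>Takes the place of a complement to \<open>P\<close>: every element of the coset becomes
  x u with u in \<open>P\<close> and with x killed by the order of the coset.\<close>

lemma coset_representative:
  assumes "X \<in> carrier Q"
  obtains x where "x \<in> X" "x [^] group.ord Q X = \<one>"
proof -
  interpret Q: group Q by (rule group_Q)
  let ?k = "Q.ord X"
  obtain y where yX: "y \<in> X" using assms rcosets_non_empty carrier_Q by auto
  then have y: "y \<in> carrier G" "X = P #> y" using mem_coset[OF assms] by auto
  have yk: "y [^] ?k \<in> P"
    using pow_coset_eq_one[OF assms yX] Q.pow_ord_eq_1[OF assms] by blast
  have "?k dvd N" using Q.ord_dvd_group_order[OF assms] unfolding order_Q .
  then have "coprime (p ^ s) ?k" using coprime_pN by (metis coprime_divisors dvd_refl)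
  moreover have "p ^ s \<noteq> 0" using p by (simp add: prime_gt_0_nat)
  \<comment> \<open>The exponent \<open>p ^ s * c\<close> is 1 modulo the order of the coset, so
    this power of \<open>y\<close> stays in \<open>X\<close>; being a multiple of
    \<open>p ^ s\<close>, it also removes the \<open>P\<close>-part \<open>y [^] ?k\<close>.\<close>
  ultimately obtain c d where cd: "p ^ s * c = ?k * d + 1"
    using bezout_nat[of "p ^ s" ?k] by (auto simp: coprime_iff_gcd_eq_1)
  let ?x = "y [^] (p ^ s * c)"
  have "?x = (y [^] ?k) [^] d \<otimes> y"
    unfolding cd using y by (simp add: nat_pow_pow)
  moreover have "(y [^] ?k) [^] d \<in> P"
    using yk by (rule P_nat_pow)
  ultimately have "?x \<in> X" using rcosI[OF _ subset y(1)] unfolding y(2) by metis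
  moreover have "?x [^] ?k = \<one>"
  proof -
    have "?x [^] ?k = ((y [^] ?k) [^] (p ^ s)) [^] c"
      using y by (simp add: nat_pow_pow ac_simps)
    also have "(y [^] ?k) [^] (p ^ s) = \<one>" using yk unfolding P_def by blast
    finally show ?thesis by simp
  qed
  ultimately show ?thesis using that by blast
qed

lemma coset_sum_reindex:
  assumes "x \<in> carrier G"
  shows "(\<Sum>y\<in>P #> x. f y) = (\<Sum>u\<in>P. f (x \<otimes> u))"
proof -
  have "P #> x = (\<lambda>u. x \<otimes> u) ` P"
    using coset_eq assms by (auto simp: l_coset_def)
  moreover have "inj_on (\<lambda>u. x \<otimes> u) P"
    using assms P_closed by (auto simp: inj_on_def)
  ultimately show ?thesis by (simp add: sum.reindex)
qed

text \<open>A single exponent serves the whole of \<open>P\<close>: it is read off at the generator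
  \<open>w\<close> and carried over to its powers.\<close>

lemma conj_power:
  assumes "x \<in> carrier G"
  shows "\<exists>l::nat. \<forall>u\<in>P. inv x \<otimes> u \<otimes> x = u [^] l"
proof -
  obtain l :: nat where l: "inv x \<otimes> w \<otimes> x = w [^] l"
    using P_pow[OF conj_in_P[OF assms w_in_P]] by auto
  have "inv x \<otimes> u \<otimes> x = u [^] l" if "u \<in> P" for u
  proof -
    obtain i :: nat where i: "u = w [^] i" using P_pow[OF \<open>u \<in> P\<close>] by auto
    show ?thesis
      unfolding i using conj_pow[OF assms w(1), of i] w(1) l by (simp add: nat_pow_pow mult.commute)
  qed
  then show ?thesis by blast
qed

text \<open>Moving a power of \<open>u\<close> to the right across \<open>x\<close> multiplies its
  exponent by \<open>l\<close>; collecting all factors \<open>u\<close> behind the factors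
  \<open>x\<close> produces the geometric sum.\<close>

lemma mult_pow_eq:
  assumes "x \<in> carrier G" "u \<in> P" "inv x \<otimes> u \<otimes> x = u [^] (l::nat)"
  shows "(x \<otimes> u) [^] (j::nat) = x [^] j \<otimes> u [^] (\<Sum>i<j. l ^ i)"
proof (induction j)
  case (Suc j)
  note u = P_closed[OF assms(2)]
  have *: "u [^] e \<otimes> x = x \<otimes> u [^] (l * e)" for e :: nat
  proof -
    have "inv x \<otimes> u [^] e \<otimes> x = u [^] (l * e)"
      using conj_pow[OF assms(1) u, of e] assms(3) u by (simp add: nat_pow_pow)
    then have "x \<otimes> u [^] (l * e) = x \<otimes> (inv x \<otimes> u [^] e \<otimes> x)" by simp
    also have "\<dots> = u [^] e \<otimes> x" using assms(1) u by (simp add: m_assoc mult_inv_cancel)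
    finally show ?thesis ..
  qed
  have "(x \<otimes> u) [^] Suc j = x [^] j \<otimes> (u [^] (\<Sum>i<j. l ^ i) \<otimes> x) \<otimes> u"
    using assms(1) u Suc by (simp add: m_assoc)
  also have "\<dots> = x [^] Suc j \<otimes> u [^] (l * (\<Sum>i<j. l ^ i) + 1)"
    unfolding * using assms(1) u by (simp add: m_assoc)
  also have "l * (\<Sum>i<j. l ^ i) + 1 = (\<Sum>i<Suc j. l ^ i)"
    unfolding sum.lessThan_Suc_shift by (simp add: sum_distrib_left)
  finally show ?case .
qed simp

text \<open>With a representative x killed by k, the order of the coset, (x u)^k is a power of u.
  Hence o(x u) divides k o(u), whatever the action on \<open>P\<close> is.\<close>

lemma coset_sum_le:
  assumes X: "X \<in> carrier Q"
  shows "(\<Sum>y\<in>X. ord y) \<le> group.ord Q X * psi_cyc (p ^ s)"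
proof -
  let ?k = "group.ord Q X"
  obtain x where x: "x \<in> X" "x [^] ?k = \<one>" using coset_representative[OF X] .
  have xG: "x \<in> carrier G" "X = P #> x" using mem_coset[OF X x(1)] by auto
  obtain l :: nat where l: "\<And>u. u \<in> P \<Longrightarrow> inv x \<otimes> u \<otimes> x = u [^] l"
    using conj_power[OF xG(1)] by blast
  have k0: "?k > 0" using group.finite_ord_pos[OF group_Q finite_Q X] .
  have "ord (x \<otimes> u) \<le> ?k * ord u" if "u \<in> P" for u
  proof (rule dvd_imp_le)
    note u = P_closed[OF that]
    have "(x \<otimes> u) [^] ?k = u [^] (\<Sum>i<?k. l ^ i)"
      using mult_pow_eq[OF xG(1) that l[OF that]] x(2) u by simp
    then have "((x \<otimes> u) [^] ?k) [^] ord u = \<one>"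
      using u by (simp add: nat_pow_pow pow_eq_id)
    then show "ord (x \<otimes> u) dvd ?k * ord u"
      using xG(1) u by (simp add: nat_pow_pow pow_eq_id)
    show "0 < ?k * ord u" using k0 finite_ord_pos[OF fin u] by simp
  qed
  then show ?thesis
    unfolding xG(2)
    by (subst coset_sum_reindex[OF xG(1)]) (auto simp: sum_distrib_left xG(2) intro!: sum_mono simp flip: sum_ord_P)
qed

text \<open>If \<open>x\<close> acts on \<open>P\<close> as the power map \<open>u \<mapsto> u\<^bsup>l\<^esup>\<close> and \<open>x\<^sup>k = \<one>\<close>, then \<open>(x u)\<^sup>k\<close> is the power of
  \<open>u\<close> with exponent \<open>1 + l + \<dots> + l\<^bsup>k-1\<^esup>\<close>. Its product with \<open>l - 1\<close> is \<open>l\<^sup>k - 1\<close>, which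
  \<open>|P|\<close> divides; and \<open>p\<close> divides at most one of the two factors, since the sum is \<open>k\<close> modulo \<open>l - 1\<close>.\<close>

lemma coset_sum_le_noncentral:
  assumes X: "X \<in> carrier Q" and nc: "\<And>y. y \<in> X \<Longrightarrow> y \<otimes> w \<noteq> w \<otimes> y"
  shows "(\<Sum>y\<in>X. ord y) \<le> group.ord Q X * p ^ s"
proof -
  interpret Q: group Q by (rule group_Q)
  let ?k = "Q.ord X"
  obtain x where x: "x \<in> X" "x [^] ?k = \<one>" using coset_representative[OF X] .
  have xG: "x \<in> carrier G" "X = P #> x" using mem_coset[OF X x(1)] by auto
  obtain l :: nat where l: "\<And>u. u \<in> P \<Longrightarrow> inv x \<otimes> u \<otimes> x = u [^] l"
    using conj_power[OF xG(1)] by blast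
  have k0: "?k > 0" using Q.finite_ord_pos[OF finite_Q X] .
  let ?e = "\<Sum>i<?k. l ^ i"
  have conj_iter: "inv (x [^] i) \<otimes> w \<otimes> x [^] i = w [^] (l ^ i)" for i :: nat
  proof (induction i)
    case (Suc i)
    have "inv (x [^] Suc i) \<otimes> w \<otimes> x [^] Suc i = inv x \<otimes> (inv (x [^] i) \<otimes> w \<otimes> x [^] i) \<otimes> x"
      using xG(1) w(1) by (simp add: inv_mult_group m_assoc)
    also have "\<dots> = (w [^] (l ^ i)) [^] l"
      unfolding Suc by (rule l[OF pow_w_in_P])
    finally show ?case using w(1) by (simp add: nat_pow_pow mult.commute)
  qed (use w in simp)
  have "w [^] (l ^ ?k) = w [^] (1::nat)"
    using conj_iter[of ?k] x(2) w(1) by simp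
  then have lk: "int (p ^ s) dvd int l ^ ?k - 1"
    unfolding nat_pow_eq_iff[OF w(1)] w(2) by simp
  have geom: "int l ^ ?k - 1 = (int l - 1) * int ?e"
    using power_diff_1_eq[of "int l" ?k] by simp
  have "coprime (int (p ^ s)) (int l - 1) \<or> coprime (int (p ^ s)) (int ?e)"
  proof (cases "int p dvd int l - 1")
    case True
    have "int p dvd int ?e - int ?k"
    proof -
      have "int ?e - int ?k = (\<Sum>i<?k. int l ^ i - 1)"
        by (simp add: sum_subtractf)
      moreover have "int p dvd int l ^ i - 1" for i
        using True power_diff_1_eq[of "int l" i] by simp
      ultimately show ?thesis by (simp add: dvd_sum)
    qed
    moreover have "\<not> p dvd ?k"
      using N Q.ord_dvd_group_order[OF X] order_Q dvd_trans by blast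
    ultimately have "\<not> int p dvd int ?e"
      by (metis dvd_diff_right_iff int_dvd_int_iff dvd_diffD1 dvd_diff_commute)
    then show ?thesis using p by (simp add: prime_imp_coprime)
  next
    case False
    then show ?thesis using p by (simp add: prime_imp_coprime)
  qed
  \<comment> \<open>This decides which factor \<open>p ^ s\<close> divides: if it divided
    \<open>l - 1\<close>, the representative would commute with \<open>w\<close>. So
    \<open>p ^ s\<close> is not coprime to the geometric sum, hence coprime to \<open>l - 1\<close>,
    and must divide the sum.\<close>
  moreover have "\<not> int (p ^ s) dvd int l - 1"
  proof
    assume "int (p ^ s) dvd int l - 1"
    then have "w [^] l = w"
      using nat_pow_eq_iff[OF w(1), of l 1] w by simp
    then have "x \<otimes> w = x \<otimes> (inv x \<otimes> w \<otimes> x)" using l[OF w_in_P] by simp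
    also have "\<dots> = w \<otimes> x" using xG(1) w(1) by (simp add: m_assoc mult_inv_cancel)
    finally have "x \<otimes> w = w \<otimes> x" .
    then show False using nc[OF x(1)] by simp
  qed
  ultimately have "int (p ^ s) dvd int ?e"
    using lk unfolding geom by (metis coprime_dvd_mult_left_iff coprime_dvd_mult_right_iff)
  then have e: "p ^ s dvd ?e" by (simp only: int_dvd_int_iff)
  have "ord (x \<otimes> u) \<le> ?k" if "u \<in> P" for u
  proof (rule dvd_imp_le)
    note u = P_closed[OF that]
    have "ord u dvd p ^ s" using that pow_eq_id[OF u] unfolding P_def by blast
    then have "ord u dvd ?e" using e by (rule dvd_trans)
    then have "u [^] ?e = \<one>" unfolding pow_eq_id[OF u] .
    then have "(x \<otimes> u) [^] ?k = \<one>"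
      using mult_pow_eq[OF xG(1) that l[OF that]] x(2) u by simp
    then show "ord (x \<otimes> u) dvd ?k" using xG(1) u by (simp add: pow_eq_id)
  qed (rule k0)
  then have "(\<Sum>u\<in>P. ord (x \<otimes> u)) \<le> card P * ?k"
    using sum_bounded_above[of P "\<lambda>u. ord (x \<otimes> u)" ?k] by simp
  then show ?thesis
    unfolding xG(2) by (subst coset_sum_reindex[OF xG(1)]) (simp add: card_P xG(2) mult.commute)
qed

lemma psi_eq_sum_cosets: "psi G = (\<Sum>X\<in>carrier Q. \<Sum>y\<in>X. ord y)"
proof -
  have "(\<Sum>y\<in>\<Union>(rcosets P). ord y) = (\<Sum>X\<in>rcosets P. \<Sum>y\<in>X. ord y)"
    using rcos_disjoint[OF subgroup_P] finite_subset[OF rcosets_carrier[OF is_group] fin]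
    by (subst sum.Union_disjoint) (auto simp: pairwise_def disjnt_def comp_def)
  then show ?thesis unfolding psi_def carrier_Q rcosets_part_G[OF subgroup_P] .
qed

lemma psi_le_psi_quotient: "psi G \<le> psi_cyc (p ^ s) * psi Q"
proof -
  have "psi G \<le> (\<Sum>X\<in>carrier Q. group.ord Q X * psi_cyc (p ^ s))"
    unfolding psi_eq_sum_cosets by (rule sum_mono) (rule coset_sum_le)
  also have "\<dots> = psi_cyc (p ^ s) * psi Q"
    unfolding psi_def[of Q] by (simp add: sum_distrib_left mult.commute)
  finally show ?thesis .
qed

end

section \<open>Noncentral Sylow subgroup with cyclic quotient\<close>

context unique_cyclic_sylow
begin

interpretation normal P G by (rule normal_P)

text \<open>Let \<open>C\<close> be the centralizer of \<open>w\<close> and \<open>l\<close> a prime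
  divisor of its index. The cosets meeting \<open>C\<close> lie in the subgroup of index
  \<open>l\<close> of the cyclic group \<open>Q\<close>; on this subgroup the general coset estimate
  is used, and outside it the noncentral one. With f for \<open>psi_cyc\<close>, the bound on
  \<psi>(G) is f(p^s) f(N/l) + p^s (f(N) - f(N/l)), written without subtraction.\<close>

lemma psi_le_cyclic_quotient:
  assumes cyc: "cyclic_group Q" and ncyc: "\<not> cyclic_group G"
  obtains l where "prime l" "l dvd N"
    "psi G + p ^ s * psi_cyc (N div l) \<le> psi_cyc (p ^ s) * psi_cyc (N div l) + p ^ s * psi_cyc N"
proof -
  interpret Q: group Q by (rule group_Q)
  obtain X0 where X0: "X0 \<in> carrier Q" "Q.ord X0 = N"
    using cyc Q.cyclic_group_iff_ord[OF finite_Q] order_Q by auto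
  define C where "C = {g \<in> carrier G. g \<otimes> w = w \<otimes> g}"
  have subC: "subgroup C G"
  proof (rule subgroupI)
    show "C \<subseteq> carrier G" "C \<noteq> {}" using w(1) by (auto simp: C_def)
    fix g assume g: "g \<in> C"
    then have gG: "g \<in> carrier G" "g \<otimes> w = w \<otimes> g" by (auto simp: C_def)
    have "inv g \<otimes> w = inv g \<otimes> (w \<otimes> g) \<otimes> inv g" using gG(1) w(1) by (simp add: m_assoc)
    also have "\<dots> = w \<otimes> inv g" using gG w(1) by (simp add: m_assoc flip: gG(2)) (simp flip: m_assoc)
    finally show "inv g \<in> C" using gG(1) by (simp add: C_def)
    fix h assume "h \<in> C"
    then have hG: "h \<in> carrier G" "h \<otimes> w = w \<otimes> h" by (auto simp: C_def)
    have "g \<otimes> h \<otimes> w = g \<otimes> (w \<otimes> h)" using gG(1) hG w(1) by (simp add: m_assoc)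
    also have "\<dots> = w \<otimes> (g \<otimes> h)" using gG(2) m_assoc gG(1) hG(1) w(1) by metis
    finally show "g \<otimes> h \<in> C" using gG(1) hG(1) by (simp add: C_def)
  qed
  have C_pow: "g [^] card C = \<one>" if "g \<in> C" for g
    using group.pow_order_eq_1[OF subgroup.subgroup_is_group[OF subC is_group], of g] that
    unfolding order_def by (simp add: nat_pow_def)
  \<comment> \<open>If \<open>P\<close> were central, a representative of order \<open>N\<close> of
    a generating coset would commute with \<open>w\<close>, and their product would have order
    \<open>N * p ^ s\<close> and generate the group.\<close>
  have "C \<noteq> carrier G"
  proof
    assume C: "C = carrier G"
    obtain x where x: "x \<in> X0" "x [^] N = \<one>" using coset_representative[OF X0(1)] X0(2) by auto
    have xG: "x \<in> carrier G" using mem_coset[OF X0(1) x(1)] by simp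
    have "X0 [^]\<^bsub>Q\<^esub> ord x = \<one>\<^bsub>Q\<^esub>"
      using pow_coset_eq_one[OF X0(1) x(1)] pow_ord_eq_1[OF xG] subgroup.one_closed[OF subgroup_P] by simp
    then have "N dvd ord x" using Q.pow_eq_id[OF X0(1)] X0(2) by simp
    moreover have "ord x dvd N" using pow_eq_id[OF xG] x(2) by simp
    ultimately have ordx: "ord x = N" by (rule dvd_antisym[symmetric])
    have "x \<in> C" using xG C by simp
    then have "x \<otimes> w = w \<otimes> x" by (simp add: C_def)
    then have "ord (x \<otimes> w) = N * p ^ s"
      using ord_dvd_order_of_commuting_mult[OF xG w(1)] coprime_pN
      unfolding ordx w(2) by (simp only: coprime_commute)
    then have "ord (x \<otimes> w) = order G" unfolding order by (simp only: mult.commute)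
    then show False using ncyc cyclic_group_iff_ord[OF fin] xG w(1) by auto
  qed
  define d where "d = card (rcosets C)"
  have d: "d * card C = p ^ s * N" using lagrange[OF subC] unfolding order d_def .
  have "d \<noteq> 1"
  proof
    assume "d = 1"
    then have "card C = order G" using d unfolding order by simp
    then have "card C = card (carrier G)" unfolding order_def .
    then show False
      using \<open>C \<noteq> carrier G\<close> card_subset_eq[OF fin] by (auto simp: C_def)
  qed
  then obtain l where l: "prime l" "l dvd d" using prime_factor_nat by auto
  \<comment> \<open>Since \<open>w\<close> lies in \<open>C\<close>, its order divides that of
    \<open>C\<close>; therefore the index \<open>d\<close> divides \<open>N\<close>, and so does
    \<open>l\<close>.\<close>
  have "p ^ s dvd card C"
    using C_pow[of w] w(1) pow_eq_id[OF w(1)] unfolding w(2) C_def by blast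
  then obtain c where c: "card C = p ^ s * c" ..
  have "p ^ s * (d * c) = p ^ s * N" using d unfolding c by (simp only: mult.left_commute)
  then have Ndc: "N = d * c" using prime_gt_0_nat[OF p] by simp
  then have lN: "l dvd N" using l(2) by simp
  obtain d' where d': "d = l * d'" using l(2) ..
  have l0: "l > 0" using prime_gt_0_nat[OF l(1)] .
  have Nl: "N div l = d' * c" using l0 unfolding Ndc d' by (simp add: mult.assoc)
  define Y where "Y = X0 [^]\<^bsub>Q\<^esub> l"
  have Y: "Y \<in> carrier Q" "Q.ord Y = N div l"
    using X0 lN l0 Q.ord_pow[OF X0(1)] by (simp_all add: Y_def)
  define Z where "Z = (\<lambda>j::nat. Y [^]\<^bsub>Q\<^esub> j) ` {..<N div l}"
  have Z: "Z \<subseteq> carrier Q" "(\<Sum>X\<in>Z. Q.ord X) = psi_cyc (N div l)"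
    using Y(1) Q.nat_pow_closed[OF Y(1)] Q.sum_ord_pow_image[OF Y(1)] unfolding Z_def Y(2) by blast+
  \<comment> \<open>If \<open>X\<close> meets \<open>C\<close>, its order divides the order
    \<open>p ^ s * c\<close> of \<open>C\<close> and is prime to \<open>p\<close>, so it divides
    \<open>c\<close> and hence \<open>N div l\<close>. In the cyclic group \<open>Q\<close> this
    puts \<open>X\<close> among the powers of \<open>Y\<close>.\<close>
  have outside: "y \<otimes> w \<noteq> w \<otimes> y" if X: "X \<in> carrier Q" "X \<notin> Z" and yX: "y \<in> X" for X y
  proof
    assume "y \<otimes> w = w \<otimes> y"
    then have "y \<in> C" using mem_coset[OF X(1) yX] by (simp add: C_def)
    then have "y [^] (p ^ s * c) \<in> P"
      using C_pow subgroup.one_closed[OF subgroup_P] unfolding c by simp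
    then have "Q.ord X dvd p ^ s * c"
      unfolding pow_coset_eq_one[OF X(1) yX, symmetric] Q.pow_eq_id[OF X(1)] .
    moreover have "coprime (Q.ord X) (p ^ s)"
      using coprime_divisors[OF Q.ord_dvd_group_order[OF X(1)] dvd_refl] coprime_pN
      unfolding order_Q by (simp only: coprime_commute)
    ultimately have "Q.ord X dvd c" by (simp only: coprime_dvd_mult_right_iff)
    then have X_one: "X [^]\<^bsub>Q\<^esub> (N div l) = \<one>\<^bsub>Q\<^esub>"
      unfolding Nl Q.pow_eq_id[OF X(1)] by simp
    obtain i :: nat where i: "X = X0 [^]\<^bsub>Q\<^esub> i"
      using X(1) Q.carrier_eq_pow_image[OF finite_Q X0(1)] unfolding X0(2) order_Q by blast
    have "N dvd i * (N div l)"
      using X_one Q.nat_pow_pow[OF X0(1)] Q.pow_eq_id[OF X0(1)] unfolding i X0(2) by simp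
    then have "l * (N div l) dvd i * (N div l)" using lN by simp
    moreover have "N div l > 0"
      using Q.finite_ord_pos[OF finite_Q Y(1)] Y(2) by simp
    ultimately have "l dvd i" by simp
    then obtain j where "i = l * j" ..
    then have "X = Y [^]\<^bsub>Q\<^esub> j" using Q.nat_pow_pow[OF X0(1)] unfolding i Y_def by simp
    also have "\<dots> = Y [^]\<^bsub>Q\<^esub> (j mod (N div l))" using Q.pow_mod_ord[OF Y(1), of j] Y(2) by simp
    finally have "X \<in> Z" using \<open>N div l > 0\<close> unfolding Z_def by simp
    with X(2) show False ..
  qed
  let ?S = "\<lambda>X. \<Sum>y\<in>X. ord y"
  have "psi G = (\<Sum>X\<in>carrier Q - Z. ?S X) + (\<Sum>X\<in>Z. ?S X)"
    unfolding psi_eq_sum_cosets by (rule sum.subset_diff[OF Z(1) finite_Q])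
  also have "(\<Sum>X\<in>Z. ?S X) \<le> (\<Sum>X\<in>Z. Q.ord X * psi_cyc (p ^ s))"
    by (rule sum_mono) (use Z(1) coset_sum_le in blast)
  also have "\<dots> = psi_cyc (N div l) * psi_cyc (p ^ s)"
    unfolding sum_distrib_right[symmetric] Z(2) ..
  also have "(\<Sum>X\<in>carrier Q - Z. ?S X) \<le> (\<Sum>X\<in>carrier Q - Z. Q.ord X * p ^ s)"
    by (rule sum_mono) (use outside coset_sum_le_noncentral in blast)
  also have "\<dots> = (\<Sum>X\<in>carrier Q - Z. Q.ord X) * p ^ s"
    unfolding sum_distrib_right ..
  finally have le: "psi G \<le> (\<Sum>X\<in>carrier Q - Z. Q.ord X) * p ^ s + psi_cyc (N div l) * psi_cyc (p ^ s)"
    by simp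
  have "psi_cyc N = (\<Sum>X\<in>carrier Q - Z. Q.ord X) + psi_cyc (N div l)"
    using Q.psi_cyclic_group[OF finite_Q cyc] sum.subset_diff[OF Z(1) finite_Q, of Q.ord]
    unfolding order_Q Z(2) psi_def by simp
  then have "p ^ s * psi_cyc N = (\<Sum>X\<in>carrier Q - Z. Q.ord X) * p ^ s + p ^ s * psi_cyc (N div l)"
    by (simp add: distrib_left mult.commute)
  with le have "psi G + p ^ s * psi_cyc (N div l) \<le> psi_cyc (p ^ s) * psi_cyc (N div l) + p ^ s * psi_cyc N"
    by (simp add: mult.commute)
  with l(1) lN show ?thesis by (rule that)
qed

end

section \<open>Consequences of a large cyclic subgroup\<close>

context group
begin

text \<open>The products u^i x^j with i < p and j < o(x) outnumber the group, so two of them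
  coincide, and with different i, since otherwise the powers of x would coincide as well. The
  difference of the exponents of u is nonzero and less than p in absolute value, hence invertible
  modulo p^s.\<close>

lemma mem_powers_of_small_index:
  assumes fin: "finite (carrier G)" and p: "prime p" and x: "x \<in> carrier G"
    and small: "order G < p * ord x" and u: "u \<in> carrier G" "u [^] (p ^ s) = \<one>"
  shows "\<exists>i::nat. u = x [^] i"
proof -
  let ?f = "\<lambda>(i::nat, j::nat). u [^] i \<otimes> x [^] j"
  have "\<not> inj_on ?f ({..<p} \<times> {..<ord x})"
  proof
    assume "inj_on ?f ({..<p} \<times> {..<ord x})"
    moreover have "?f ` ({..<p} \<times> {..<ord x}) \<subseteq> carrier G" using x u by auto
    ultimately have "card ({..<p} \<times> {..<ord x}) \<le> card (carrier G)"
      using fin by (rule card_inj_on_le)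
    then show False using small unfolding order_def by simp
  qed
  then obtain i j i' j' where ij: "i < p" "i' < p" "j < ord x" "j' < ord x" "(i, j) \<noteq> (i', j')"
    and eq: "u [^] i \<otimes> x [^] j = u [^] i' \<otimes> x [^] j'"
    by (auto simp: inj_on_def)
  have "i \<noteq> i'"
  proof
    assume "i = i'"
    then have "x [^] j = x [^] j'" using eq x u by simp
    then have "j = j'" using inj_on_pow_ord[OF x] ij by (auto simp: inj_on_def)
    with \<open>i = i'\<close> ij(5) show False by simp
  qed
  let ?d = "int i - int i'" and ?e = "int j' - int j"
  have "u [^] ?d = x [^] ?e"
  proof -
    have "u [^] i \<otimes> x [^] j \<otimes> inv (x [^] j) = u [^] i' \<otimes> x [^] j' \<otimes> inv (x [^] j)" using eq by simp
    then have "u [^] i = u [^] i' \<otimes> (x [^] j' \<otimes> inv (x [^] j))" using x u by (simp add: m_assoc)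
    then have "inv (u [^] i') \<otimes> u [^] i = x [^] j' \<otimes> inv (x [^] j)" using x u
      by (simp add: m_assoc[symmetric])
    moreover have "inv (u [^] i') \<otimes> u [^] i = u [^] ?d"
      using int_pow_mult[OF u(1), of "- int i'" "int i"] u(1) by (simp add: int_pow_neg int_pow_int)
    moreover have "x [^] j' \<otimes> inv (x [^] j) = x [^] ?e"
      using int_pow_diff[OF x, of "int j'" "int j"] by (simp add: int_pow_int)
    ultimately show ?thesis by simp
  qed
  have "\<not> int p dvd ?d"
  proof
    assume "int p dvd ?d"
    then have "\<bar>int p\<bar> \<le> \<bar>?d\<bar>" using \<open>i \<noteq> i'\<close> by (intro dvd_imp_le_int) auto
    then show False using ij by auto
  qed
  then have "coprime (int p ^ s) ?d" using p by (simp add: prime_imp_coprime)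
  \<comment> \<open>Modulo \<open>p ^ s\<close>, \<open>a\<close> is the inverse of
    \<open>?d\<close>; it recovers \<open>u\<close> from \<open>u [^] ?d\<close>.\<close>
  then obtain b a where ab: "b * int p ^ s + a * ?d = 1"
    using bezout_int[of "int p ^ s" ?d] by (metis coprime_iff_gcd_eq_1)
  have "u [^] (int p ^ s * b) = \<one>"
    using u int_pow_pow[OF u(1), of "int p ^ s" b] int_pow_int[of G u "p ^ s"] by simp
  then have "u = (u [^] ?d) [^] a"
    using int_pow_mult[OF u(1), of "int p ^ s * b" "?d * a"] u(1) ab
    by (simp add: int_pow_pow mult.commute)
  then have "u = x [^] (?e * a)" using x \<open>u [^] ?d = x [^] ?e\<close> by (simp add: int_pow_pow)
  then show ?thesis using ex_nat_pow_eq_int_pow[OF fin x] by simp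
qed

text \<open>The index of the subgroup generated by \<open>x\<close> is less than \<open>p\<close>,
  hence prime to \<open>p\<close>. So \<open>p ^ s\<close> divides \<open>ord x\<close>, and a
  suitable power of \<open>x\<close> generates the Sylow subgroup.\<close>

lemma unique_cyclic_sylow_of_small_index:
  assumes fin: "finite (carrier G)" and p: "prime p" and x: "x \<in> carrier G"
    and small: "order G < p * ord x" and ordG: "order G = p ^ s * N" and N: "\<not> p dvd N"
  shows "unique_cyclic_sylow G (x [^] (ord x div p ^ s)) p s N"
proof -
  obtain j where j: "order G = ord x * j" using ord_dvd_group_order[OF x] ..
  have ox: "ord x > 0" using finite_ord_pos[OF fin x] .
  have jp: "j < p" using small unfolding j by (simp add: mult.commute)
  have "order G > 0" using fin order_gt_0_iff_finite by simp
  then have "j > 0" unfolding j by simp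
  with jp have "\<not> p dvd j" by (auto dest: dvd_imp_le)
  then have "coprime (p ^ s) j" using prime_imp_coprime[OF p] by simp
  moreover have "p ^ s dvd ord x * j" unfolding j[symmetric] ordG by simp
  ultimately have "p ^ s dvd ord x" by (simp only: coprime_dvd_mult_left_iff)
  then obtain k where k: "ord x = p ^ s * k" ..
  have p0: "p ^ s > 0" using prime_gt_0_nat[OF p] by simp
  have kd: "ord x div p ^ s = k" unfolding k using p0 by simp
  have "k > 0" using ox unfolding k by simp
  have ordw: "ord (x [^] k) = p ^ s"
    using ord_pow[OF x, of k] \<open>k > 0\<close> unfolding k by simp
  show ?thesis
    unfolding kd
  proof (intro unique_cyclic_sylow.intro unique_cyclic_sylow_axioms.intro)
    fix u assume u: "u \<in> carrier G" "u [^] (p ^ s) = \<one>"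
    obtain i :: nat where i: "u = x [^] i" using mem_powers_of_small_index[OF fin p x small u] by blast
    have "ord x dvd i * p ^ s" using u(2) x unfolding i by (simp add: nat_pow_pow pow_eq_id)
    then have "p ^ s * k dvd p ^ s * i" unfolding k by (simp only: mult.commute)
    then have "k dvd i" using prime_gt_0_nat[OF p] by simp
    then obtain m where "i = k * m" ..
    then have "u = (x [^] k) [^] m" using x unfolding i by (simp add: nat_pow_pow)
    then show "\<exists>i::nat. u = (x [^] k) [^] i" by blast
  qed (use fin p x ordw ordG N is_group in auto)
qed

text \<open>For \<open>y\<close> outside the cyclic subgroup of index \<open>2\<close>, write \<open>y\<^sup>2 = x\<^sup>t\<close> and \<open>x y = y x\<^bsup>l\<^esup>\<close>. Then
  \<open>(y x)\<^sup>2 = x\<^bsup>t+l+1\<^esup>\<close>, so if both \<open>y\<close> and \<open>y x\<close> have the same order as \<open>x\<close>, then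
  \<open>t \<equiv> t + l + 1 \<equiv> 2\<close> modulo \<open>4\<close>. But \<open>y\<^sup>2\<close> commutes with \<open>y\<close>, that is, \<open>t l \<equiv> t\<close> modulo the order
  of \<open>x\<close>, which is impossible modulo \<open>8\<close>.\<close>

lemma index_two_not_both_maximal:
  assumes fin: "finite (carrier G)" and x: "x \<in> carrier G" "ord x = 2 ^ (a + 2)" and a: "a \<ge> 1"
    and ordG: "order G = 2 * ord x"
    and y: "y \<in> carrier G" "y \<notin> (\<lambda>i::nat. x [^] i) ` {..<ord x}"
    and oy: "ord y = ord x" and oyx: "ord (y \<otimes> x) = ord x"
  shows False
proof -
  let ?H = "(\<lambda>i::nat. x [^] i) ` {..<ord x}"
  have pow_H: "x [^] (i::nat) \<in> ?H" for i
    using pow_mod_ord[OF x(1), of i] finite_ord_pos[OF fin x(1)]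
    by (metis imageI lessThan_iff mod_less_divisor)
  have y_notin: "y \<noteq> x [^] (i::nat)" for i using y(2) pow_H by metis
  let ?K = "(\<lambda>h. y \<otimes> h) ` ?H"
  have KG: "?K \<subseteq> carrier G" "?H \<subseteq> carrier G" using x(1) y(1) by auto
  have "inj_on (\<lambda>h. y \<otimes> h) ?H" using x(1) y(1) by (auto simp: inj_on_def)
  then have "card ?K = ord x" using card_image[OF inj_on_pow_ord[OF x(1)]] by (simp add: card_image)
  moreover have "?H \<inter> ?K = {}"
  proof -
    have False if "x [^] (i::nat) = y \<otimes> x [^] (j::nat)" for i j
    proof -
      have "y = x [^] i \<otimes> inv (x [^] j)" using that x(1) y(1) by (simp add: m_assoc)
      also have "\<dots> = x [^] (int i - int j)" using int_pow_diff[OF x(1)] by (simp add: int_pow_int)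
      finally show False using y_notin ex_nat_pow_eq_int_pow[OF fin x(1)] by metis
    qed
    then show ?thesis by blast
  qed
  ultimately have "card (?H \<union> ?K) = card (carrier G)"
    using ordG card_image[OF inj_on_pow_ord[OF x(1)]]
    by (subst card_Un_disjoint) (simp_all add: order_def)
  then have cover: "carrier G = ?H \<union> ?K"
    using KG fin by (intro card_subset_eq[symmetric]) auto
  have "y \<otimes> y \<notin> ?K"
    using y y_notin x(1) by auto
  then obtain t :: nat where t: "y \<otimes> y = x [^] t" using cover y(1) m_closed by blast
  have "x \<otimes> y \<notin> ?H"
  proof
    assume "x \<otimes> y \<in> ?H"
    then obtain i :: nat where "x \<otimes> y = x [^] i" by blast
    then have "y = inv x \<otimes> x [^] i" using x(1) y(1) by (metis inv_solve_left nat_pow_closed)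
    also have "\<dots> = x [^] (- 1 + int i)"
      using int_pow_mult[OF x(1), of "- 1" "int i"] x(1) by (simp add: int_pow_neg int_pow_int)
    finally show False using y_notin ex_nat_pow_eq_int_pow[OF fin x(1)] by metis
  qed
  then obtain l :: nat where l: "x \<otimes> y = y \<otimes> x [^] l" using cover x(1) y(1) m_closed by blast
  have push: "x [^] i \<otimes> y = y \<otimes> x [^] (l * i)" for i :: nat
  proof (induction i)
    case (Suc i)
    have "x [^] Suc i \<otimes> y = x [^] i \<otimes> y \<otimes> x [^] l"
      using x(1) y(1) l by (simp add: m_assoc)
    also have "\<dots> = y \<otimes> x [^] (l * i + l)"
      unfolding Suc using x(1) y(1) by (simp add: m_assoc nat_pow_mult)
    finally show ?case by (simp add: add.commute)
  qed (use x(1) y(1) in simp)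
  have yx2: "(y \<otimes> x) \<otimes> (y \<otimes> x) = x [^] (t + l + 1)"
  proof -
    have "(y \<otimes> x) \<otimes> (y \<otimes> x) = y \<otimes> (x \<otimes> y) \<otimes> x" using x(1) y(1) by (simp add: m_assoc)
    also have "\<dots> = (y \<otimes> y) \<otimes> x [^] l \<otimes> x" unfolding l using x(1) y(1) by (simp add: m_assoc)
    also have "\<dots> = x [^] (t + l + 1)" unfolding t using x(1) by (simp add: nat_pow_mult)
    finally show ?thesis .
  qed
  \<comment> \<open>As \<open>z\<close> and \<open>x\<close> have the same order, a power of 2, the
    square x^t of \<open>z\<close> has half that order; so \<open>t\<close> is even but not
    divisible by 4.\<close>
  have mod4: "t mod 4 = 2" if z: "z \<in> carrier G" "ord z = ord x" "z \<otimes> z = x [^] t" for z and t :: nat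
  proof -
    have zp: "z [^] (2 * m) = x [^] (t * m)" for m :: nat
    proof -
      have "z [^] (2::nat) = x [^] t" using z by (simp add: numeral_2_eq_2)
      then show ?thesis
        unfolding nat_pow_pow[OF z(1), symmetric] nat_pow_pow[OF x(1), symmetric] by simp
    qed
    have "x [^] (t * 2 ^ (a + 1)) = \<one>"
      using zp[of "2 ^ (a + 1)"] pow_ord_eq_1[OF z(1)] z(2) x(2) by simp
    then have "2 ^ (a + 1) * 2 dvd 2 ^ (a + 1) * t"
      unfolding pow_eq_id[OF x(1)] x(2) by (simp add: mult.commute)
    then have "2 dvd t" by (metis dvd_times_left_cancel_iff power_not_zero zero_neq_numeral)
    moreover have "\<not> 4 dvd t"
    proof
      assume "4 dvd t"
      then have "ord x dvd t * 2 ^ a" unfolding x(2) by (simp add: power_add mult.commute mult_dvd_mono)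
      then have "z [^] (2 * 2 ^ a :: nat) = \<one>" unfolding zp pow_eq_id[OF x(1)] .
      then have "(2::nat) ^ (a + 2) dvd 2 ^ (a + 1)" unfolding pow_eq_id[OF z(1)] z(2) x(2) by simp
      then have "a + 2 \<le> a + 1" by (rule power_dvd_imp_le) simp
      then show False by simp
    qed
    ultimately show ?thesis by presburger
  qed
  have t4: "t mod 4 = 2" using mod4[OF y(1) oy t] .
  have "(t + l + 1) mod 4 = 2" using mod4[OF m_closed[OF y(1) x(1)] oyx yx2] .
  with t4 have l4: "l mod 4 = 3" by presburger
  have "y \<otimes> x [^] t = y \<otimes> x [^] (l * t)"
    using push[of t] t y(1) by (metis m_assoc)
  then have "x [^] (l * t) = x [^] t" using x(1) y(1) by simp
  then have dv: "int (ord x) dvd int (l * t) - int t" unfolding nat_pow_eq_iff[OF x(1)] .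
  \<comment> \<open>Here \<open>a \<ge> 1\<close> enters: the congruence may be read modulo 8, where
    t (l - 1) = (4i + 2)(4j + 2) leaves 4. For \<open>a = 0\<close> the quaternion group does
    contain such a pair.\<close>
  have "(2::int) ^ 3 dvd int (ord x)" unfolding x(2) using a by (cases a) simp_all
  from dvd_trans[OF this dv] have "8 dvd int (l * t) - int t" by simp
  moreover obtain i where "t = 4 * i + 2" using t4 by (metis mult_div_mod_eq)
  moreover obtain j where "l = 4 * j + 3" using l4 by (metis mult_div_mod_eq)
  ultimately have "8 dvd 8 * (2 * int j * int i + int j + int i) + 4"
    by (simp add: algebra_simps)
  then show False by presburger
qed

text \<open>Averages over \<open>y\<close> and \<open>y \<otimes> x\<close>. Right multiplication by
  \<open>x\<close> permutes the complement of the cyclic subgroup, and of the two elements at most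
  one has order 2^(a+2), the other at most 2^(a+1). The average order over the 2^(a+2) outside
  elements is thus at most 3 times 2^a.\<close>

lemma psi_two_group_cyclic_index_two:
  assumes fin: "finite (carrier G)" and ordG: "order G = 2 ^ (a + 3)" and a: "a \<ge> 1"
    and ncyc: "\<not> cyclic_group G" and x: "x \<in> carrier G" "ord x = 2 ^ (a + 2)"
  shows "psi G \<le> psi_cyc (2 ^ (a + 2)) + 3 * 2 ^ (2 * a + 2)"
proof -
  let ?H = "(\<lambda>i::nat. x [^] i) ` {..<ord x}"
  let ?R = "carrier G - ?H"
  have ord_cases: "ord z \<le> 2 ^ (a + 1) \<or> ord z = ord x" if "z \<in> carrier G" for z
  proof -
    have "ord z dvd 2 ^ (a + 3)" using ord_dvd_group_order[OF that] unfolding ordG .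
    then obtain k where k: "k \<le> a + 3" "ord z = 2 ^ k"
      using divides_primepow_nat[OF two_is_prime_nat] by blast
    have "k \<noteq> a + 3" using ncyc cyclic_group_iff_ord[OF fin] that k(2) ordG by auto
    then consider "k = a + 2" | "k \<le> a + 1" using k(1) by linarith
    then show ?thesis using k(2) x(2) power_increasing[of k "a + 1" "2::nat"] by cases simp_all
  qed
  have pair: "ord y + ord (y \<otimes> x) \<le> 3 * 2 ^ (a + 1)" if "y \<in> ?R" for y
  proof -
    have "\<not> (ord y = ord x \<and> ord (y \<otimes> x) = ord x)"
    proof -
      have "order G = 2 * ord x" unfolding ordG x(2) by (simp add: power_add)
      then show ?thesis using index_two_not_both_maximal[OF fin x a] that by blast
    qed
    then show ?thesis using ord_cases[of y] ord_cases[of "y \<otimes> x"] that x by auto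
  qed
  have H_closed: "z \<in> ?H \<Longrightarrow> z \<otimes> x [^] (j::nat) \<in> ?H" for z j
  proof -
    assume "z \<in> ?H"
    then obtain i :: nat where "z = x [^] i" by blast
    then have "z \<otimes> x [^] j = x [^] ((i + j) mod ord x)"
      using pow_mod_ord[OF x(1), of "i + j"] x(1) by (simp add: nat_pow_mult)
    then show ?thesis using finite_ord_pos[OF fin x(1)] by (metis imageI lessThan_iff mod_less_divisor)
  qed
  have "(\<lambda>y. y \<otimes> x) ` ?R = ?R"
  proof (rule endo_inj_surj)
    show "(\<lambda>y. y \<otimes> x) ` ?R \<subseteq> ?R"
    proof (rule image_subsetI, rule DiffI)
      fix y assume "y \<in> ?R"
      then have y: "y \<in> carrier G" "y \<notin> ?H" by auto
      show "y \<otimes> x \<notin> ?H"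
      proof
        assume "y \<otimes> x \<in> ?H"
        from H_closed[OF this, of "ord x - 1"] have "y \<otimes> (x \<otimes> x [^] (ord x - 1)) \<in> ?H"
          using x(1) y(1) by (simp add: m_assoc)
        moreover have "x \<otimes> x [^] (ord x - 1) = \<one>"
          using finite_ord_pos[OF fin x(1)] pow_ord_eq_1[OF x(1)] nat_pow_Suc2[OF x(1), of "ord x - 1"]
          by simp
        ultimately show False using y by simp
      qed
      show "y \<otimes> x \<in> carrier G" using x y by simp
    qed
    show "inj_on (\<lambda>y. y \<otimes> x) ?R" using x by (auto simp: inj_on_def)
  qed (use fin in auto)
  moreover have "inj_on (\<lambda>y. y \<otimes> x) ?R" using x by (auto simp: inj_on_def)
  ultimately have "(\<Sum>y\<in>?R. ord (y \<otimes> x)) = (\<Sum>y\<in>?R. ord y)"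
    using sum.reindex[of "\<lambda>y. y \<otimes> x" ?R ord] by (simp add: comp_def)
  then have "2 * (\<Sum>y\<in>?R. ord y) = (\<Sum>y\<in>?R. ord y + ord (y \<otimes> x))"
    by (simp add: sum.distrib)
  also have "\<dots> \<le> card ?R * (3 * 2 ^ (a + 1))"
    using sum_bounded_above[of ?R "\<lambda>y. ord y + ord (y \<otimes> x)", OF pair] by simp
  also have "card ?R = 2 ^ (a + 2)"
    using card_diff_powers[OF fin x(1)] unfolding ordG x(2) by (simp add: power_add)
  finally have "(\<Sum>y\<in>?R. ord y) \<le> 3 * 2 ^ (2 * a + 2)"
    by (simp add: power_add mult_2[of a])
  then show ?thesis using psi_eq_powers_plus_rest[OF fin x(1)] x(2) by simp
qed

end

section \<open>The upper bounds\<close>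

definition G1_ratio :: "nat \<Rightarrow> real"
  where "G1_ratio \<alpha> = (2 ^ (2 * \<alpha> + 3) + 7) / (7 * (2 ^ (2 * \<alpha> + 1) + 1))"

text \<open>At \<alpha> = 1 the formula gives 39/63 = 13/21, so this case needs no clause of its
  own.\<close>

definition even_ratio :: "nat \<Rightarrow> real"
  where "even_ratio \<alpha> = (if \<alpha> = 2 then 7 / 11 else if \<alpha> = 3 then 27 / 43 else G1_ratio \<alpha>)"

lemma G1_ratio_4: "G1_ratio \<alpha> = (8 * 4 ^ \<alpha> + 7) / (7 * (2 * 4 ^ \<alpha> + 1))"
  unfolding G1_ratio_def by (simp add: power_add power_mult)

lemma G1_ratio_gt: "4 / 7 < G1_ratio \<alpha>"
proof -
  have "(4::real) ^ \<alpha> > 0" by simp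
  then show ?thesis unfolding G1_ratio_4 by (simp add: field_simps add_pos_pos)
qed

lemma G1_ratio_le_even_ratio: "G1_ratio \<alpha> \<le> even_ratio \<alpha>"
  by (simp add: even_ratio_def G1_ratio_def)

lemma real_psi_cyc_prime_power:
  assumes "prime p"
  shows "(real p + 1) * real (psi_cyc (p ^ k)) = real p * real (p ^ k) ^ 2 + 1"
proof -
  have "real ((p + 1) * psi_cyc (p ^ k)) = real (p ^ (2 * k + 1) + 1)"
    by (simp only: psi_cyc_prime_power[OF assms])
  then show ?thesis
    unfolding of_nat_mult of_nat_add of_nat_power of_nat_1
    by (simp add: power_mult power2_eq_square mult.commute flip: power_mult_distrib)
qed

text \<open>Sharp at \<open>p ^ s = 3\<close>, where \<open>psi_cyc\<close> has the value 7; this is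
  the origin of the 7 in the denominator of \<open>G1_ratio\<close>.\<close>

lemma odd_prime_power_le_psi_cyc:
  assumes p: "prime p" "p \<ge> 3" and s: "s > 0"
  shows "7 * real (p ^ s) \<le> 3 * real (psi_cyc (p ^ s))"
proof -
  let ?q = "real (p ^ s)" and ?p = "real p"
  have "p ^ 1 \<le> p ^ s" using s p(2) by (intro power_increasing) auto
  then have "3 \<le> p ^ s" using p(2) by simp
  then have "real 3 \<le> ?q" by (simp only: of_nat_le_iff)
  then have q: "?q \<ge> 3" by simp
  have p3: "?p \<ge> 3" using p(2) by simp
  \<comment> \<open>This product is the case \<open>p = 3\<close> of the inequality; for larger
    \<open>p\<close> the difference of its sides grows because 3 q > 7.\<close>
  have "0 \<le> (9 * ?q - 1) * (?q - 3)" using q by (intro mult_nonneg_nonneg) auto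
  moreover have "3 * (?q * (3 * ?q - 7)) \<le> ?p * (?q * (3 * ?q - 7))"
    using p3 q by (intro mult_right_mono) auto
  ultimately have "7 * ?q * (?p + 1) \<le> 3 * (?p * ?q ^ 2 + 1)"
    by (simp add: power2_eq_square algebra_simps)
  also have "\<dots> = 3 * real (psi_cyc (p ^ s)) * (?p + 1)"
    using real_psi_cyc_prime_power[OF p(1), of s] by (simp only: mult.commute mult.left_commute)
  finally show ?thesis by (rule mult_right_le_imp_le) simp
qed

text \<open>For cyclic \<open>Q\<close> start from \<psi>(G) \<le> (F - q) u + q B. Inserting u
  \<le> B (h + 1) / (4h + 1) and q \<le> 3F/7 gives F B the coefficient (h + 1) / (4h + 1) + 9h / (7
  (4h + 1)), which is \<open>G1_ratio \<alpha>\<close>. For noncyclic \<open>Q\<close> the bound is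
  inherited by multiplicativity.\<close>

lemma (in unique_cyclic_sylow) psi_le_even_ratio:
  assumes p3: "p \<ge> 3" and s: "s > 0" and ncyc: "\<not> cyclic_group G"
    and Nm: "N = 2 ^ \<alpha> * m" "odd m" "\<alpha> \<ge> 1"
    and quot: "\<not> cyclic_group Q \<Longrightarrow> real (psi Q) \<le> even_ratio \<alpha> * real (psi_cyc N)"
  shows "real (psi G) \<le> even_ratio \<alpha> * real (psi_cyc (order G))"
proof -
  have f: "real (psi_cyc (order G)) = real (psi_cyc (p ^ s)) * real (psi_cyc N)"
    unfolding order psi_cyc_mult[OF coprime_pN] by simp
  show ?thesis
  proof (cases "cyclic_group Q")
    case False
    have "real (psi G) \<le> real (psi_cyc (p ^ s)) * real (psi Q)"
      using psi_le_psi_quotient by (simp flip: of_nat_mult)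
    also have "\<dots> \<le> real (psi_cyc (p ^ s)) * (even_ratio \<alpha> * real (psi_cyc N))"
      using quot[OF False] by (intro mult_left_mono) auto
    finally show ?thesis unfolding f by (simp only: mult.left_commute)
  next
    case True
    obtain l where l: "prime l" "l dvd N"
      and le: "psi G + p ^ s * psi_cyc (N div l) \<le> psi_cyc (p ^ s) * psi_cyc (N div l) + p ^ s * psi_cyc N"
      using psi_le_cyclic_quotient[OF True ncyc] .
    define F where "F = real (psi_cyc (p ^ s))"
    define q where "q = real (p ^ s)"
    define u where "u = real (psi_cyc (N div l))"
    define B where "B = real (psi_cyc N)"
    define h where "h = (2::real) ^ (2 * \<alpha> - 1)"
    have h4: "(2::real) ^ (2 * \<alpha> + 1) = 4 * h" "(2::real) ^ (2 * \<alpha> + 3) = 16 * h"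
      using Nm(3) unfolding h_def by (cases \<alpha>; simp add: power_add)+
    have h0: "h > 0" "B \<ge> 0" "u \<ge> 0" by (simp_all add: h_def B_def u_def)
    have qF: "7 * q \<le> 3 * F"
      unfolding q_def F_def by (rule odd_prime_power_le_psi_cyc[OF p p3 s])
    have "real (psi G + p ^ s * psi_cyc (N div l)) \<le> real (psi_cyc (p ^ s) * psi_cyc (N div l) + p ^ s * psi_cyc N)"
      using le by (simp only: of_nat_le_iff)
    then have 1: "real (psi G) + q * u \<le> F * u + q * B"
      unfolding q_def F_def u_def B_def by simp
    have "real ((2 ^ (2 * \<alpha> + 1) + 1) * psi_cyc (N div l)) \<le> real ((2 ^ (2 * \<alpha> - 1) + 1) * psi_cyc N)"
      using psi_cyc_div_prime[OF l Nm] by (simp only: of_nat_le_iff)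
    then have 2: "(4 * h + 1) * u \<le> (h + 1) * B"
      unfolding of_nat_mult of_nat_add of_nat_power of_nat_numeral of_nat_1 h4 h_def[symmetric]
        u_def[symmetric] B_def[symmetric] .
    have q0: "q \<ge> 0" unfolding q_def by simp
    \<comment> \<open>The bound on \<psi>(G) increases with \<open>u\<close> because F \<ge> q, so
      the upper bound for \<open>u\<close> may be inserted.\<close>
    have "(F - q) * ((4 * h + 1) * u) \<le> (F - q) * ((h + 1) * B)"
      using 2 qF q0 by (intro mult_left_mono) auto
    moreover have "h * B * (7 * q) \<le> h * B * (3 * F)"
      using qF h0 by (intro mult_left_mono) auto
    moreover have "(4 * h + 1) * real (psi G) \<le> (4 * h + 1) * (F * u + q * B - q * u)"
      using 1 h0 by (intro mult_left_mono) auto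
    ultimately have "7 * (4 * h + 1) * real (psi G) \<le> (16 * h + 7) * (F * B)"
      by (simp add: algebra_simps)
    then have "real (psi G) \<le> G1_ratio \<alpha> * (F * B)"
      using h0 unfolding G1_ratio_def h4 by (simp add: field_simps)
    also have "\<dots> \<le> even_ratio \<alpha> * (F * B)"
      using G1_ratio_le_even_ratio h0 by (intro mult_right_mono) (auto simp: F_def)
    finally show ?thesis unfolding f F_def B_def .
  qed
qed

section \<open>Noncyclic 2-groups, and an element of small index otherwise\<close>

context group
begin

lemma psi_le_uniform:
  assumes "finite (carrier G)" "\<And>y. y \<in> carrier G \<Longrightarrow> ord y \<le> M"
  shows "psi G \<le> order G * M"
  unfolding psi_def order_def using assms(2) sum_bounded_above[of "carrier G" ord M] by simp

text \<open>Here \<open>u\<close> is the square of the group order. Without an element of order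
  2^(\<alpha>-1) all orders are at most a quarter of the group order, and u/4 is small enough. With
  such an element, the care needed for its complement depends on \<alpha>.\<close>

lemma psi_two_group_le_even_ratio:
  assumes fin: "finite (carrier G)" and ordG: "order G = 2 ^ \<alpha>" and ncyc: "\<not> cyclic_group G"
  shows "real (psi G) \<le> even_ratio \<alpha> * real (psi_cyc (order G))"
proof -
  have ord_pow2: "\<exists>k<\<alpha>. ord z = 2 ^ k" if "z \<in> carrier G" for z
  proof -
    have "ord z dvd 2 ^ \<alpha>" using ord_dvd_group_order[OF that] unfolding ordG .
    then obtain k where k: "k \<le> \<alpha>" "ord z = 2 ^ k"
      using divides_primepow_nat[OF two_is_prime_nat] by blast
    moreover have "k \<noteq> \<alpha>" using ncyc cyclic_group_iff_ord[OF fin] that k(2) ordG by auto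
    ultimately show ?thesis by auto
  qed
  have ord_le: "ord z \<le> 2 ^ (\<alpha> - 1)" if "z \<in> carrier G" for z
    using ord_pow2[OF that] by (auto intro: power_increasing)
  obtain k where "k < \<alpha>" using ord_pow2[OF one_closed] by blast
  have "\<alpha> \<noteq> 1"
  proof
    assume "\<alpha> = 1"
    then have "ord z = 1" if "z \<in> carrier G" for z using ord_pow2[OF that] by auto
    then have "carrier G \<subseteq> {\<one>}" using ord_eq_1 by blast
    then have "order G \<le> 1" unfolding order_def using card_mono[of "{\<one>}" "carrier G"] by simp
    then show False using ordG \<open>\<alpha> = 1\<close> by simp
  qed
  then have "\<alpha> \<ge> 2" using \<open>k < \<alpha>\<close> by linarith
  define u where "u = (4::real) ^ \<alpha>"
  have u: "real ((2 ^ \<alpha>)) ^ 2 = u" unfolding u_def by (simp add: power2_eq_square flip: power_mult_distrib)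
  have f: "3 * real (psi_cyc (2 ^ \<alpha>)) = 2 * u + 1"
    using real_psi_cyc_prime_power[OF two_is_prime_nat, of \<alpha>] u by simp
  have f': "3 * real (psi_cyc (2 ^ (\<alpha> - 1))) = u / 2 + 1"
  proof -
    have "4 * real (2 ^ (\<alpha> - 1)) ^ 2 = u"
      unfolding u[symmetric] using \<open>\<alpha> \<ge> 2\<close> by (cases \<alpha>) (simp_all add: power2_eq_square)
    then show ?thesis using real_psi_cyc_prime_power[OF two_is_prime_nat, of "\<alpha> - 1"] by simp
  qed
  have ratio: "G1_ratio \<alpha> * real (psi_cyc (2 ^ \<alpha>)) = (8 * u + 7) / 21"
  proof -
    have "u > 0" unfolding u_def by simp
    moreover have "real (psi_cyc (2 ^ \<alpha>)) = (2 * u + 1) / 3" using f by simp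
    ultimately show ?thesis unfolding G1_ratio_4 u_def[symmetric] by (simp add: divide_simps)
  qed
  show ?thesis
  proof (cases "\<exists>x\<in>carrier G. ord x = 2 ^ (\<alpha> - 1)")
    case False
    have "ord z \<le> 2 ^ (\<alpha> - 2)" if z: "z \<in> carrier G" for z
    proof -
      obtain k where k: "k < \<alpha>" "ord z = 2 ^ k" using ord_pow2[OF z] by blast
      then have "k \<noteq> \<alpha> - 1" using False z by auto
      with k show ?thesis by (auto intro: power_increasing)
    qed
    then have "psi G \<le> 2 ^ \<alpha> * 2 ^ (\<alpha> - 2)" using psi_le_uniform[OF fin] unfolding ordG by blast
    then have "real (psi G) \<le> real (2 ^ \<alpha> * 2 ^ (\<alpha> - 2))" by (simp only: of_nat_le_iff)
    also have "\<dots> = u / 4"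
    proof -
      obtain j where "\<alpha> = Suc (Suc j)" using \<open>\<alpha> \<ge> 2\<close> by (metis Suc_le_D numeral_2_eq_2 Suc_le_mono)
      then show ?thesis unfolding u[symmetric] by (simp add: power2_eq_square)
    qed
    also have "\<dots> \<le> G1_ratio \<alpha> * real (psi_cyc (2 ^ \<alpha>))"
      unfolding ratio by (simp add: u_def field_simps add_increasing)
    also have "\<dots> \<le> even_ratio \<alpha> * real (psi_cyc (2 ^ \<alpha>))"
      using G1_ratio_le_even_ratio by (intro mult_right_mono) auto
    finally show ?thesis unfolding ordG .
  next
    case True
    then obtain x where x: "x \<in> carrier G" "ord x = 2 ^ (\<alpha> - 1)" by blast
    show ?thesis
    proof (cases "\<alpha> \<ge> 4")
      case True
      define b where "b = \<alpha> - 3"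
      have b: "\<alpha> = b + 3" "b \<ge> 1" "\<alpha> - 1 = b + 2" using True by (simp_all add: b_def)
      have "psi G \<le> psi_cyc (2 ^ (b + 2)) + 3 * 2 ^ (2 * b + 2)"
      proof (rule psi_two_group_cyclic_index_two[OF fin _ b(2) ncyc x(1)])
        show "order G = 2 ^ (b + 3)" using ordG b(1) by simp
        show "ord x = 2 ^ (b + 2)" using x(2) unfolding b(3) .
      qed
      then have "real (psi G) \<le> real (psi_cyc (2 ^ (b + 2)) + 3 * 2 ^ (2 * b + 2))"
        by (simp only: of_nat_le_iff)
      also have "\<dots> = real (psi_cyc (2 ^ (b + 2))) + 3 * u / 16"
        unfolding u_def b(1) by (simp add: power_add power_mult)
      \<comment> \<open>The left side is 17u/48 + 1/3. Giving every outside element the order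
        2^(\<alpha>-1) would yield 5u/12 + 1/3, which is above the bound.\<close>
      also have "\<dots> \<le> (8 * u + 7) / 21"
      proof -
        have "u \<ge> 0" unfolding u_def by simp
        then show ?thesis using f' unfolding b(3) by simp
      qed
      also have "\<dots> = even_ratio \<alpha> * real (psi_cyc (order G))"
        using True ratio unfolding ordG by (simp add: even_ratio_def)
      finally show ?thesis .
    next
      case False
      then have "\<alpha> = 2 \<or> \<alpha> = 3" using \<open>\<alpha> \<ge> 2\<close> by linarith
      \<comment> \<open>This count gives 3 + 4 = 7 for order 4 and 11 + 16 = 27 for order 8, exactly
        the order sums of the extremal groups.\<close>
      moreover have "psi G \<le> psi_cyc (2 ^ (\<alpha> - 1)) + (2 ^ \<alpha> - 2 ^ (\<alpha> - 1)) * 2 ^ (\<alpha> - 1)"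
        using psi_le_of_ord_bound[OF fin x(1) ord_le] unfolding ordG x(2) .
      then have "real (psi G) \<le> real (psi_cyc (2 ^ (\<alpha> - 1)) + (2 ^ \<alpha> - 2 ^ (\<alpha> - 1)) * 2 ^ (\<alpha> - 1))"
        by (simp only: of_nat_le_iff)
      ultimately show ?thesis
        using f f' unfolding ordG u_def by (auto simp: even_ratio_def)
    qed
  qed
qed

lemma ex_small_index_element:
  assumes fin: "finite (carrier G)" and ordG: "order G = 2 ^ \<alpha> * m" "odd m" "\<alpha> \<ge> 1"
    and p: "prime p" "p dvd m" "prime_factors (order G) \<subseteq> {..p}"
    and large: "G1_ratio \<alpha> * real (psi_cyc (order G)) < real (psi G)"
  shows "\<exists>x\<in>carrier G. order G < p * ord x"
proof -
  let ?n = "order G"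
  have n0: "?n > 0" using fin order_gt_0_iff_finite by simp
  have "finite (ord ` carrier G)" "ord ` carrier G \<noteq> {}" using fin by auto
  then obtain x where x: "x \<in> carrier G" "ord x = Max (ord ` carrier G)"
    using Max_in by (metis imageE)
  then have max: "ord y \<le> ord x" if "y \<in> carrier G" for y
    using fin that by simp
  define M where "M = ord x"
  have psi_le: "real (psi G) \<le> real ?n * real M"
    using psi_le_uniform[OF fin max] unfolding M_def by (simp flip: of_nat_mult)
  have f0: "real (psi_cyc ?n) > 0" using psi_cyc_pos[OF n0] by simp
  have "4 / 7 * real (psi_cyc ?n) < G1_ratio \<alpha> * real (psi_cyc ?n)"
    using G1_ratio_gt f0 by (intro mult_strict_right_mono)
  with large psi_le have nM: "4 / 7 * real (psi_cyc ?n) < real ?n * real M" by linarith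
  have "odd p" using p(2) ordG(2) dvd_trans by blast
  then have "p \<noteq> 2" "p \<noteq> 4" by auto
  moreover have "p \<ge> 2" using prime_ge_2_nat[OF p(1)] .
  ultimately consider "p \<ge> 5" | "p = 3" by linarith
  then show ?thesis
  proof cases
    case 1
    have "5 * real ?n ^ 2 \<le> 2 * (real p + 1) * real (psi_cyc ?n)"
      by (rule psi_cyc_ge_largest_prime[OF n0 p(3) 1])
    also have "\<dots> < 2 * (real p + 1) * (7 / 4 * (real ?n * real M))"
      using nM by (intro mult_strict_left_mono) auto
    finally have "real ?n * (10 * real ?n) < real ?n * (7 * (real p + 1) * real M)"
      by (simp add: power2_eq_square algebra_simps)
    then have "10 * real ?n < 7 * (real p + 1) * real M"
      by (rule mult_left_less_imp_less) simp
    also have "\<dots> \<le> (10 * real p) * real M"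
      using 1 by (intro mult_right_mono) auto
    finally have "real ?n < real (p * ord x)" unfolding M_def by simp
    then show ?thesis using x(1) by (auto simp only: of_nat_less_iff)
  next
    case 2
    have m0: "m > 0" using ordG(2) by (rule odd_pos)
    define k where "k = multiplicity 3 m"
    obtain m' where m': "m = 3 ^ k * m'" "\<not> 3 dvd m'"
      unfolding k_def by (rule multiplicity_decompose'[of m 3]) (use m0 in auto)
    have "m' = 1"
    proof (rule ccontr)
      assume "m' \<noteq> 1"
      then obtain q where q: "prime q" "q dvd m'" using prime_factor_nat by blast
      then have "q dvd ?n" unfolding ordG(1) m'(1) by simp
      then have "q \<le> 3" using p(3) q(1) n0 2 by (auto simp: prime_factors_dvd)
      moreover have "q \<noteq> 3" using q(2) m'(2) by auto
      moreover have "q \<noteq> 2" using q(2) ordG(2) unfolding m'(1) by auto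
      ultimately show False using prime_ge_2_nat[OF q(1)] by linarith
    qed
    then have m3: "m = 3 ^ k" using m' by simp
    then have "k > 0" using p(2) 2 by (cases k) auto
    then obtain j where j: "k = Suc j" by (cases k) auto
    define u where "u = (4::real) ^ \<alpha>"
    define V where "V = (9::real) ^ j"
    have V1: "V \<ge> 1" "u \<ge> 0" by (simp_all add: V_def u_def)
    have sq: "real (2 ^ \<alpha>) ^ 2 = u" "real (3 ^ j) ^ 2 = V"
      unfolding u_def V_def by (simp_all add: power2_eq_square flip: power_mult_distrib)
    have cop: "coprime (2 ^ \<alpha>) (3 ^ i :: nat)" for i by simp
    have f2: "3 * real (psi_cyc (2 ^ \<alpha>)) = 2 * u + 1"
      using real_psi_cyc_prime_power[OF two_is_prime_nat, of \<alpha>] sq by simp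
    have pr3: "prime (3::nat)" using p(1) 2 by simp
    have f3: "4 * real (psi_cyc (3 ^ j)) = 3 * V + 1"
      using real_psi_cyc_prime_power[OF pr3, of j] sq by simp
    have f3': "4 * real (psi_cyc (3 ^ Suc j)) = 27 * V + 1"
      using real_psi_cyc_prime_power[OF pr3, of "Suc j"] sq by (simp add: power_mult_distrib)
    have n: "?n = 3 * (2 ^ \<alpha> * 3 ^ j)" unfolding ordG(1) m3 j by simp
    have fn: "12 * real (psi_cyc ?n) = (2 * u + 1) * (27 * V + 1)"
      unfolding ordG(1) m3 j psi_cyc_mult[OF cop] of_nat_mult f2[symmetric] f3'[symmetric] by simp
    have fn3: "12 * real (psi_cyc (2 ^ \<alpha> * 3 ^ j)) = (2 * u + 1) * (3 * V + 1)"
      unfolding psi_cyc_mult[OF cop] of_nat_mult f2[symmetric] f3[symmetric] by simp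
    have n2: "real ?n ^ 2 = 9 * (u * V)"
      unfolding n by (simp add: power_mult_distrib flip: sq)
    obtain i where i: "?n = M * i" using ord_dvd_group_order[OF x(1)] unfolding M_def ..
    have M0: "M > 0" using n0 unfolding i by simp
    \<comment> \<open>With 2 and 3 as the only primes, \<open>psi_cyc\<close> exceeds half the
      square of the group order n. Hence n M is more than 2/7 of n^2, and the index is below
      7/2.\<close>
    have "i < 4"
    proof (rule ccontr)
      assume "\<not> i < 4"
      then have "4 * M \<le> ?n" unfolding i by (simp add: mult.commute)
      then have "real (4 * M) \<le> real ?n" by (simp only: of_nat_le_iff)
      then have "4 * real M \<le> real ?n" by simp
      then have "4 * (real ?n * real M) \<le> real ?n ^ 2"
        unfolding power2_eq_square by (simp add: mult.left_commute mult_left_mono)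
      then have "16 / 7 * (12 * real (psi_cyc ?n)) \<le> 12 * real ?n ^ 2" using nM by linarith
      then have "16 * ((2 * u + 1) * (27 * V + 1)) \<le> 756 * (u * V)"
        unfolding fn n2 by simp
      moreover have "(2 * u + 1) * (27 * V + 1) = 54 * (u * V) + 2 * u + 27 * V + 1"
        by (simp add: algebra_simps)
      moreover have "0 \<le> u * V" using V1 by simp
      ultimately show False using V1 by linarith
    qed
    \<comment> \<open>Index 3 passes the previous test, as 1/3 > 2/7. Counting the cyclic subgroup
      exactly replaces n M = 3 M^2 by f(M) + 2 M^2, which no longer exceeds the bound.\<close>
    moreover have "i \<noteq> 3"
    proof
      assume "i = 3"
      then have M: "M = 2 ^ \<alpha> * 3 ^ j" using n i by simp
      have nM3: "?n = 3 * M" using i \<open>i = 3\<close> by simp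
      have "psi G \<le> psi_cyc M + (?n - M) * M"
        using psi_le_of_ord_bound[OF fin x(1) max] unfolding M_def .
      also have "(?n - M) * M = 2 * M ^ 2" unfolding nM3 by (simp add: power2_eq_square)
      finally have "real (psi G) \<le> real (psi_cyc M + 2 * M ^ 2)" by (simp only: of_nat_le_iff)
      also have "\<dots> = real (psi_cyc M) + 2 * (u * V)"
        unfolding M by (simp add: power_mult_distrib flip: sq)
      finally have "84 * real (psi G) \<le> 7 * ((2 * u + 1) * (3 * V + 1)) + 168 * (u * V)"
        using fn3 unfolding M by linarith
      also have "\<dots> \<le> (8 * u + 7) * (27 * V + 1)"
      proof -
        have "u * 1 \<le> u * V" using V1 by (intro mult_left_mono)
        then show ?thesis using V1 by (simp add: algebra_simps)
      qed
      also have "\<dots> = 84 * (G1_ratio \<alpha> * real (psi_cyc ?n))"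
      proof -
        have "84 * (G1_ratio \<alpha> * real (psi_cyc ?n)) = 7 * G1_ratio \<alpha> * (12 * real (psi_cyc ?n))" by simp
        also have "\<dots> = (8 * u + 7) * (27 * V + 1)"
          unfolding fn G1_ratio_4 u_def[symmetric] using V1 by (simp add: field_simps)
        finally show ?thesis ..
      qed
      finally show False using large by simp
    qed
    ultimately have "i < p" using 2 by linarith
    then have "?n < p * ord x" using M0 unfolding i M_def[symmetric] by (simp add: mult.commute)
    then show ?thesis using x(1) by blast
  qed
qed

end

text \<open>Only odd primes are divided out, so \<alpha> stays fixed while \<open>m\<close> varies
  in the induction. If \<open>m\<close> is not 1, the largest prime divisor is odd, and a group
  already below \<open>G1_ratio\<close> needs no further argument.\<close>

lemma psi_le_even_ratio_nat:
  fixes G :: "nat monoid"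
  assumes "group G" "finite (carrier G)" "\<not> cyclic_group G"
    "order G = 2 ^ \<alpha> * m" "odd m" "\<alpha> \<ge> 1"
  shows "real (psi G) \<le> even_ratio \<alpha> * real (psi_cyc (order G))"
  using assms
proof (induction "order G" arbitrary: G m rule: less_induct)
  case less
  interpret group G by fact
  note fin = less.prems(2) and ordG = less.prems(4)
  have n0: "order G > 0" using fin order_gt_0_iff_finite by simp
  show ?case
  proof (cases "m = 1")
    case True
    then show ?thesis using psi_two_group_le_even_ratio[OF fin _ less.prems(3), of \<alpha>] ordG by simp
  next
    case m1: False
    define p where "p = Max (prime_factors (order G))"
    obtain r where r: "prime r" "r dvd m" using m1 prime_factor_nat by blast
    have rn: "r \<in> prime_factors (order G)"
      using r n0 ordG by (intro prime_factorsI) auto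
    then have pin: "p \<in> prime_factors (order G)" unfolding p_def by (intro Max_in) auto
    then have p: "prime p" "p dvd order G" by auto
    have sub: "prime_factors (order G) \<subseteq> {..p}" unfolding p_def by auto
    have "r \<noteq> 2" using r(2) less.prems(5) by auto
    then have "r \<ge> 3" using prime_ge_2_nat[OF r(1)] by linarith
    moreover have "r \<le> p" using sub rn by auto
    ultimately have p3: "p \<ge> 3" by linarith
    have "\<not> p dvd 2 ^ \<alpha>"
      using p(1) p3 prime_dvd_power[of p 2 \<alpha>] dvd_imp_le[of p 2] by auto
    then have pm: "p dvd m" using p prime_dvd_multD[OF p(1)] unfolding ordG by blast
    show ?thesis
    proof (cases "G1_ratio \<alpha> * real (psi_cyc (order G)) < real (psi G)")
      case False
      have "G1_ratio \<alpha> * real (psi_cyc (order G)) \<le> even_ratio \<alpha> * real (psi_cyc (order G))"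
        using G1_ratio_le_even_ratio by (intro mult_right_mono) auto
      with False show ?thesis by linarith
    next
      case True
      obtain x where x: "x \<in> carrier G" "order G < p * ord x"
        using ex_small_index_element[OF fin ordG less.prems(5,6) p(1) pm sub True] by blast
      have m0: "m > 0" using less.prems(5) by (rule odd_pos)
      obtain s m' where m': "m = p ^ s * m'" "\<not> p dvd m'"
        using multiplicity_decompose'[of m p] m0 p(1) by (metis not_prime_unit less_numeral_extra(3))
      define N where "N = 2 ^ \<alpha> * m'"
      have nN: "order G = p ^ s * N" unfolding ordG m'(1) N_def by simp
      have pN: "\<not> p dvd N"
        using m'(2) \<open>\<not> p dvd 2 ^ \<alpha>\<close> prime_dvd_multD[OF p(1)] unfolding N_def by blast
      have s0: "s > 0" using pm m' by (cases s) auto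
      have "odd m'" using less.prems(5) unfolding m'(1) by auto
      interpret unique_cyclic_sylow G "x [^]\<^bsub>G\<^esub> (ord x div p ^ s)" p s N
        by (rule unique_cyclic_sylow_of_small_index[OF fin p(1) x nN pN])
      show ?thesis
      proof (rule psi_le_even_ratio[OF p3 s0 less.prems(3) N_def \<open>odd m'\<close> less.prems(6)])
        assume ncyc: "\<not> cyclic_group Q"
        obtain H :: "nat monoid" where H: "group H" "Q \<cong> H"
          using finite_group_iso_nat[OF group_Q finite_Q] .
        have oH: "order H = N"
          using iso_same_card[OF H(2)] order_Q unfolding order_def by simp
        have "N > 0" using n0 unfolding nN by simp
        have "1 < p ^ s" using p3 s0 by (intro one_less_power) auto
        then have "order H < order G" using \<open>N > 0\<close> unfolding oH nN by simp
        moreover have "finite (carrier H)" using iso_finite[OF H(2)] finite_Q by simp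
        moreover have "\<not> cyclic_group H"
          using ncyc isomorphic_group_cyclicity[OF H(2) group_Q H(1)] by simp
        ultimately have "real (psi H) \<le> even_ratio \<alpha> * real (psi_cyc (order H))"
          using less.hyps[of H m'] H(1) oH N_def \<open>odd m'\<close> less.prems(6) by simp
        then show "real (psi Q) \<le> even_ratio \<alpha> * real (psi_cyc N)"
          unfolding oH psi_iso[OF H(2) group_Q H(1)] .
      qed
    qed
  qed
qed

lemma noncyclic_even_group_ratio_le:
  fixes G :: "'a monoid"
  assumes "noncyclic_even_group G n \<alpha> m"
  shows "real (psi G) / real (psi (integer_mod_group n)) \<le> even_ratio \<alpha>"
proof -
  have G: "group G" "finite (carrier G)" "\<not> cyclic_group G" "order G = n" "even n" "n = 2 ^ \<alpha> * m" "odd m"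
    using assms unfolding noncyclic_even_group_def by auto
  have "\<alpha> \<ge> 1" using G(5-7) by (cases \<alpha>) auto
  obtain H :: "nat monoid" where H: "group H" "G \<cong> H" using finite_group_iso_nat[OF G(1,2)] .
  have "order H = 2 ^ \<alpha> * m" using iso_same_card[OF H(2)] G(4,6) unfolding order_def by simp
  moreover have "finite (carrier H)" using iso_finite[OF H(2)] G(2) by simp
  moreover have "\<not> cyclic_group H" using G(3) isomorphic_group_cyclicity[OF H(2) G(1) H(1)] by simp
  ultimately have "real (psi H) \<le> even_ratio \<alpha> * real (psi_cyc (order H))"
    using psi_le_even_ratio_nat[OF H(1)] G(7) \<open>\<alpha> \<ge> 1\<close> by blast
  moreover have "order H = n" using iso_same_card[OF H(2)] G(4) unfolding order_def by simp
  moreover have n0: "n > 0" using G(6) odd_pos[OF G(7)] by simp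
  ultimately show ?thesis
    using psi_cyc_pos[OF n0] unfolding psi_iso[OF H(2) G(1) H(1)] psi_integer_mod_group[OF n0]
    by (simp add: divide_le_eq)
qed

section \<open>The extremal groups\<close>

lemma sum_lessThan_double:
  fixes g :: "nat \<Rightarrow> 'b::comm_monoid_add"
  shows "(\<Sum>i<2 * n. g i) = (\<Sum>r<n. g (2 * r) + g (2 * r + 1))"
  by (induction n) (simp_all add: add.assoc)

lemma psi_cyc_3: "psi_cyc 3 = 7"
  using psi_cyc_prime_power[of 3 1] by simp

text \<open>Common frame for \<open>S\<^sub>3\<close> (with \<alpha> = 1) and the presented group;
  \<open>BA\<close> is b^a = b^-1 in the form of a rule for moving \<open>B\<close> past
  \<open>A\<close>. That \<open>A\<close> and \<open>B\<close> generate is supplied separately: by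
  counting for \<open>S\<^sub>3\<close>, by a normal form for the presented group.\<close>

locale dihedral_type = group G for G (structure) +
  fixes A B \<alpha>
  assumes \<alpha>: "\<alpha> \<ge> 1"
    and A: "A \<in> carrier G" "ord A = 2 ^ \<alpha>"
    and B: "B \<in> carrier G" "ord B = 3"
    and BA: "B \<otimes> A = A \<otimes> inv B"
begin

lemma inv_B: "inv B = B [^] (2::nat)"
proof -
  have "B [^] (2::nat) \<otimes> B = \<one>"
    using pow_ord_eq_1[OF B(1)] B by (simp add: numeral_3_eq_3 numeral_2_eq_2)
  then show ?thesis using B(1) by (intro inv_equality) simp_all
qed

lemma invB_A: "inv B \<otimes> A = A \<otimes> B"
proof -
  have "inv B \<otimes> A = inv B \<otimes> (A \<otimes> inv B) \<otimes> B" using A(1) B(1) by (simp add: m_assoc)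
  also have "\<dots> = A \<otimes> B" unfolding BA[symmetric] using A(1) B(1) by (simp flip: m_assoc)
  finally show ?thesis .
qed

lemma conj_A: "inv A \<otimes> (B \<otimes> A) = inv B"
  unfolding BA using A(1) B(1) by (simp flip: m_assoc)

lemma B_A2: "B \<otimes> A [^] (2 * r) = A [^] (2 * r :: nat) \<otimes> B"
proof (induction r)
  case (Suc r)
  have "B \<otimes> A [^] (2 * Suc r) = (B \<otimes> A [^] (2 * r)) \<otimes> A \<otimes> A"
    using A(1) B(1) by (simp add: m_assoc)
  also have "\<dots> = A [^] (2 * r) \<otimes> (B \<otimes> A) \<otimes> A"
    unfolding Suc using A(1) B(1) by (simp add: m_assoc)
  also have "\<dots> = A [^] (2 * r) \<otimes> A \<otimes> (inv B \<otimes> A)"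
    unfolding BA using A(1) B(1) by (simp add: m_assoc)
  also have "\<dots> = A [^] (2 * Suc r) \<otimes> B"
    unfolding invB_A using A(1) B(1) by (simp add: m_assoc)
  finally show ?case .
qed (use A B in simp)

lemma Bj_commute_even: "B [^] (j::nat) \<otimes> A [^] (2 * r) = A [^] (2 * r :: nat) \<otimes> B [^] j"
proof (induction j)
  case (Suc j)
  have "B [^] Suc j \<otimes> A [^] (2 * r) = B [^] j \<otimes> (B \<otimes> A [^] (2 * r))"
    using A(1) B(1) by (simp add: m_assoc)
  also have "\<dots> = (B [^] j \<otimes> A [^] (2 * r)) \<otimes> B"
    unfolding B_A2 using A(1) B(1) by (simp add: m_assoc)
  also have "\<dots> = A [^] (2 * r) \<otimes> B [^] Suc j"
    unfolding Suc using A(1) B(1) by (simp add: m_assoc)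
  finally show ?case .
qed (use A B in simp)

lemma Bj_A: "B [^] (j::nat) \<otimes> A = A \<otimes> inv B [^] j"
proof (induction j)
  case (Suc j)
  have "B [^] Suc j \<otimes> A = B [^] j \<otimes> (B \<otimes> A)" using A(1) B(1) by (simp add: m_assoc)
  also have "\<dots> = (B [^] j \<otimes> A) \<otimes> inv B" unfolding BA using A(1) B(1) by (simp add: m_assoc)
  also have "\<dots> = A \<otimes> inv B [^] Suc j" unfolding Suc using A(1) B(1) by (simp add: m_assoc)
  finally show ?case .
qed (use A B in simp)

lemma common_power_trivial:
  assumes "z \<in> carrier G" "z [^] ((2::nat) ^ \<alpha>) = \<one>" "z [^] (3::nat) = \<one>"
  shows "z = \<one>"
proof -
  have "ord z dvd 2 ^ \<alpha>" "ord z dvd 3" using assms pow_eq_id by auto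
  moreover have "coprime (2 ^ \<alpha>) (3::nat)" by simp
  ultimately have "ord z = 1" using coprime_common_divisor[of "2 ^ \<alpha>" 3 "ord z"] by simp
  then show ?thesis using ord_eq_1[OF assms(1)] by simp
qed

text \<open>If two normal forms agree, one element is a power of \<open>A\<close> and of
  \<open>B\<close> at once. Its order divides both 2^\<alpha> and 3, so it is trivial.\<close>

lemma inj_normal_form: "inj_on (\<lambda>(i::nat, j::nat). A [^] i \<otimes> B [^] j) ({..<2 ^ \<alpha>} \<times> {..<3})"
proof (rule inj_onI, clarsimp)
  fix i j k l :: nat
  assume bounds: "i < 2 ^ \<alpha>" "j < 3" "k < 2 ^ \<alpha>" "l < 3"
    and eq: "A [^] i \<otimes> B [^] j = A [^] k \<otimes> B [^] l"
  define z where "z = inv (A [^] k) \<otimes> A [^] i"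
  have zA: "z = A [^] (- int k + int i)"
    unfolding z_def using int_pow_mult[OF A(1), of "- int k" "int i"] A(1) by (simp add: int_pow_neg int_pow_int)
  have "z = inv (A [^] k) \<otimes> (A [^] i \<otimes> B [^] j) \<otimes> inv (B [^] j)"
    unfolding z_def using A(1) B(1) by (simp add: m_assoc)
  also have "\<dots> = B [^] l \<otimes> inv (B [^] j)"
    unfolding eq using A(1) B(1) by (simp flip: m_assoc)
  also have "\<dots> = B [^] (int l - int j)"
    using int_pow_diff[OF B(1)] by (simp add: int_pow_int)
  finally have zB: "z = B [^] (int l - int j)" .
  have "z = \<one>"
  proof (rule common_power_trivial)
    show "z \<in> carrier G" unfolding zA using A(1) by simp
    show "z [^] ((2::nat) ^ \<alpha>) = \<one>"
      unfolding zA using int_pow_pow[OF A(1), of "- int k + int i" "int (2 ^ \<alpha>)"] A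
      by (simp add: int_pow_int[symmetric] int_pow_eq_id del: of_nat_power)
    show "z [^] (3::nat) = \<one>"
      unfolding zB using int_pow_pow[OF B(1), of "int l - int j" "int 3"] B
      by (simp add: int_pow_int[symmetric] int_pow_eq_id del: of_nat_numeral)
  qed
  then have "int (2 ^ \<alpha>) dvd int i - int k" "int 3 dvd int l - int j"
    using zA zB int_pow_eq_id[OF A(1), of "- int k + int i"] int_pow_eq_id[OF B(1), of "int l - int j"] A(2) B(2)
    by auto
  then have "i mod 2 ^ \<alpha> = k mod 2 ^ \<alpha>" "l mod 3 = j mod 3"
    by (simp_all only: mod_eq_dvd_iff[symmetric] zmod_int[symmetric] of_nat_eq_iff)
  with bounds show "i = k \<and> j = l" by simp
qed

text \<open>An odd power of \<open>A\<close> inverts \<open>B\<close>, so the square of A^i B^j is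
  A^(2i): even powers of the element involve \<open>A\<close> alone, and odd powers are never
  trivial.\<close>

lemma ord_odd:
  assumes "odd (i::nat)"
  shows "ord (A [^] i \<otimes> B [^] (j::nat)) = 2 ^ \<alpha>"
proof -
  let ?y = "A [^] i \<otimes> B [^] j"
  have y: "?y \<in> carrier G" using A(1) B(1) by simp
  obtain r where r: "i = 2 * r + 1" using assms by (metis oddE)
  have "B [^] j \<otimes> A [^] i = A [^] i \<otimes> inv B [^] j"
  proof -
    have "B [^] j \<otimes> A [^] i = (B [^] j \<otimes> A [^] (2 * r)) \<otimes> A"
      unfolding r using A(1) B(1) by (simp add: m_assoc)
    also have "\<dots> = A [^] (2 * r) \<otimes> (B [^] j \<otimes> A)"
      unfolding Bj_commute_even using A(1) B(1) by (simp add: m_assoc)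
    also have "\<dots> = A [^] i \<otimes> inv B [^] j"
      unfolding Bj_A r using A(1) B(1) by (simp add: m_assoc)
    finally show ?thesis .
  qed
  then have "?y \<otimes> ?y = A [^] i \<otimes> (A [^] i \<otimes> inv B [^] j) \<otimes> B [^] j"
    using A(1) B(1) by (simp add: m_assoc) (simp flip: m_assoc)
  also have "\<dots> = A [^] (2 * i)"
    using A(1) B(1) by (simp add: m_assoc nat_pow_inv nat_pow_mult mult_2)
  finally have "?y [^] (2::nat) = A [^] (2 * i)" using y by (simp add: numeral_2_eq_2)
  then have even: "?y [^] (2 * t) = A [^] (i * (2 * t))" for t
    using nat_pow_pow[OF y, of 2 t] nat_pow_pow[OF A(1), of "2 * i" t] by (simp add: ac_simps)
  have copr: "coprime ((2::nat) ^ \<alpha>) i" using assms by simp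
  have "?y [^] t = \<one> \<longleftrightarrow> 2 ^ \<alpha> dvd t" for t :: nat
  proof (cases "even t")
    case True
    then obtain t' where "t = 2 * t'" ..
    then have "?y [^] t = \<one> \<longleftrightarrow> 2 ^ \<alpha> dvd i * t"
      using even[of t'] pow_eq_id[OF A(1)] A(2) by simp
    then show ?thesis using copr by (simp only: coprime_dvd_mult_right_iff)
  next
    case False
    then obtain t' where t': "t = 2 * t' + 1" by (metis oddE)
    have "?y [^] t = A [^] (i * (2 * t')) \<otimes> ?y"
      unfolding t' using even[of t'] y by simp
    also have "\<dots> = A [^] (i * t) \<otimes> B [^] j"
      unfolding t' using A(1) B(1) by (simp add: nat_pow_mult distrib_left add.commute[of i] flip: m_assoc)
    finally have yt: "?y [^] t = A [^] (i * t) \<otimes> B [^] j" .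
    have "?y [^] t \<noteq> \<one>"
    proof
      assume "?y [^] t = \<one>"
      then have "A [^] (i * t) = inv (B [^] j)"
        unfolding yt using A(1) B(1) by (metis inv_equality inv_inv nat_pow_closed)
      \<comment> \<open>Cubing removes \<open>B\<close> and leaves a power of \<open>A\<close> with
        the odd exponent 3 i t, which cannot be trivial.\<close>
      then have "(A [^] (i * t)) [^] (3::nat) = (inv (B [^] j)) [^] (3::nat)" by simp
      also have "\<dots> = \<one>"
        using B by (simp add: nat_pow_inv nat_pow_pow pow_eq_id)
      finally have "2 ^ \<alpha> dvd i * t * 3" using A by (simp add: nat_pow_pow pow_eq_id)
      moreover have "2 dvd (2::nat) ^ \<alpha>" using \<alpha> by simp
      ultimately have "2 dvd i * t * 3" by (rule dvd_trans[rotated])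
      then show False using assms False by simp
    qed
    moreover have "\<not> 2 ^ \<alpha> dvd t" using False \<alpha> dvd_trans[of 2 "2 ^ \<alpha>" t] by auto
    ultimately show ?thesis by simp
  qed
  then show ?thesis using ord_unique[OF y] by simp
qed

lemma ord_even: "ord (A [^] (2 * r :: nat) \<otimes> B [^] (j::nat)) = ord (A [^] (2 * r)) * ord (B [^] j)"
proof (rule ord_dvd_order_of_commuting_mult)
  have "ord (A [^] (2 * r)) dvd 2 ^ \<alpha>" "ord (B [^] j) dvd 3"
    using A B by (simp_all add: nat_pow_pow flip: pow_eq_id) (simp_all add: pow_eq_id)
  moreover have "coprime (2 ^ \<alpha>) (3::nat)" by simp
  ultimately show "coprime (ord (A [^] (2 * r))) (ord (B [^] j))" by (rule coprime_divisors)
qed (use A B Bj_commute_even in simp_all)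

context
  assumes gen: "carrier G \<subseteq> (\<lambda>(i::nat, j::nat). A [^] i \<otimes> B [^] j) ` ({..<2 ^ \<alpha>} \<times> {..<3})"
begin

lemma carrier_eq: "carrier G = (\<lambda>(i::nat, j::nat). A [^] i \<otimes> B [^] j) ` ({..<2 ^ \<alpha>} \<times> {..<3})"
  using gen A(1) B(1) by auto

lemma order_eq: "order G = 2 ^ \<alpha> * 3"
  unfolding order_def carrier_eq card_image[OF inj_normal_form] by simp

text \<open>Elements are sorted by the parity of the exponent of \<open>A\<close>. The odd ones all
  have order 2^\<alpha>. Even powers of \<open>A\<close> commute with \<open>B\<close>, so orders
  multiply and these elements sum to 7 f(2^(\<alpha>-1)), with f for \<open>psi_cyc\<close>. The
  factor 3 clears the denominator of f.\<close>

lemma psi_eq: "3 * psi G = 2 ^ (2 * \<alpha> + 3) + 7"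
proof -
  obtain \<beta> where \<beta>: "\<alpha> = Suc \<beta>" using \<alpha> by (cases \<alpha>) auto
  have "psi G = (\<Sum>(i, j)\<in>{..<2 ^ \<alpha>} \<times> {..<3}. ord (A [^] (i::nat) \<otimes> B [^] (j::nat)))"
    unfolding psi_def carrier_eq sum.reindex[OF inj_normal_form] by (simp add: case_prod_unfold comp_def)
  also have "\<dots> = (\<Sum>i<2 * 2 ^ \<beta>. \<Sum>j<3. ord (A [^] (i::nat) \<otimes> B [^] (j::nat)))"
    unfolding sum.cartesian_product \<beta> by simp
  also have "\<dots> = (\<Sum>r<2 ^ \<beta>. (\<Sum>j<3. ord (A [^] (2 * r :: nat)) * ord (B [^] (j::nat))) + 3 * 2 ^ \<alpha>)"
  proof -
    have odd: "ord (A [^] (2 * r + 1) \<otimes> B [^] j) = 2 ^ \<alpha>" for r j :: nat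
      by (rule ord_odd) simp
    show ?thesis unfolding sum_lessThan_double ord_even odd by simp
  qed
  also have "\<dots> = (\<Sum>r<2 ^ \<beta>. ord (A [^] (2 * r :: nat)) * 7) + 2 ^ \<beta> * (3 * 2 ^ \<alpha>)"
    using sum_ord_pow[OF B(1)] B(2) psi_cyc_3 by (simp add: sum.distrib flip: sum_distrib_left)
  also have "(\<Sum>r<2 ^ \<beta>. ord (A [^] (2 * r :: nat)) * 7) = psi_cyc (2 ^ \<beta>) * 7"
  proof -
    have "ord (A [^] (2::nat)) = 2 ^ \<beta>" using ord_pow[OF A(1), of 2] A(2) \<beta> by simp
    then show ?thesis
      using sum_ord_pow[of "A [^] (2::nat)"] A(1) by (simp add: nat_pow_pow flip: sum_distrib_right)
  qed
  finally have "3 * psi G = 7 * ((2 + 1) * psi_cyc (2 ^ \<beta>)) + 9 * (2 ^ \<beta> * 2 ^ \<alpha>)" by simp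
  also have "(2 + 1) * psi_cyc (2 ^ \<beta>) = 2 * (2 ^ \<beta> * 2 ^ \<beta>) + 1"
    unfolding psi_cyc_prime_power[OF two_is_prime_nat] by (simp add: mult_2 power_add)
  also have "7 * (2 * (2 ^ \<beta> * 2 ^ \<beta>) + 1) + 9 * (2 ^ \<beta> * 2 ^ \<alpha>) = 32 * (2 ^ \<beta> * 2 ^ \<beta>) + (7::nat)"
    unfolding \<beta> by simp
  also have "32 * (2 ^ \<beta> * 2 ^ \<beta>) = (2::nat) ^ (\<beta> + \<beta> + 5)"
    unfolding power_add by simp
  also have "\<beta> + \<beta> + 5 = 2 * \<alpha> + 3"
    unfolding \<beta> by simp
  finally show ?thesis .
qed

lemma not_cyclic: "\<not> cyclic_group G"
proof
  assume "cyclic_group G"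
  then interpret comm_group G by (rule cyclic_imp_abelian_group)
  have "A \<otimes> B = A \<otimes> inv B" using BA m_comm A(1) B(1) by simp
  then have "B = B [^] (2::nat)" using A(1) B(1) by (simp add: inv_B)
  then have "B [^] (1::nat) = B [^] (2::nat)" using B(1) by simp
  then show False unfolding nat_pow_eq_iff[OF B(1)] B(2) by simp
qed

end

end

lemma psi_ratio_dihedral_type:
  assumes "3 * psi G = 2 ^ (2 * \<alpha> + 3) + 7"
  shows "real (psi G) / real (psi (integer_mod_group (2 ^ \<alpha> * 3))) =
    (2 ^ (2 * \<alpha> + 3) + 7) / (7 * (2 ^ (2 * \<alpha> + 1) + 1))"
proof -
  have "real (3 * psi G) = real (2 ^ (2 * \<alpha> + 3) + 7)" using assms by (simp only:)
  then have psi: "real (psi G) = (2 ^ (2 * \<alpha> + 3) + 7) / 3" by simp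
  have "coprime (2 ^ \<alpha>) (3::nat)" by simp
  then have cyc: "psi (integer_mod_group (2 ^ \<alpha> * 3)) = psi_cyc (2 ^ \<alpha>) * 7"
    using psi_integer_mod_group[of "2 ^ \<alpha> * 3"] psi_cyc_mult psi_cyc_3 by simp
  have "real ((2 + 1) * psi_cyc (2 ^ \<alpha>)) = real (2 ^ (2 * \<alpha> + 1) + 1)"
    using psi_cyc_prime_power[OF two_is_prime_nat, of \<alpha>] by (simp only:)
  then have "real (psi_cyc (2 ^ \<alpha>)) = (2 ^ (2 * \<alpha> + 1) + 1) / 3" by simp
  then have "real (psi (integer_mod_group (2 ^ \<alpha> * 3))) = (2 ^ (2 * \<alpha> + 1) + 1) / 3 * 7"
    unfolding cyc by simp
  then show ?thesis unfolding psi by (simp add: divide_simps)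
qed

section \<open>The symmetric group, the Klein four-group and the quaternion group\<close>

definition S3_a :: "nat \<Rightarrow> nat" where "S3_a = transpose 1 2"

text \<open>A 3-cycle written as \<open>S3_a\<close> followed in the product by another
  transposition. Its inverse is the reversed product, which turns the relation \<open>BA\<close>
  into associativity.\<close>

definition S3_b :: "nat \<Rightarrow> nat" where "S3_b = transpose 1 2 \<circ> transpose 2 3"

lemma dihedral_type_S3: "dihedral_type (sym_group 3) S3_a S3_b 1"
proof -
  interpret group "sym_group 3" by (rule sym_group_is_group)
  note sg = sym_group_carrier sym_group_mult sym_group_one
  have perm: "transpose 1 2 permutes {1..3::nat}" "transpose 2 3 permutes {1..3::nat}"
    by (auto intro: permutes_swap_id)
  have ab: "S3_a \<in> carrier (sym_group 3)" "S3_b \<in> carrier (sym_group 3)"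
    unfolding sg S3_a_def S3_b_def using perm by (auto intro: permutes_compose)
  have a2: "S3_a \<circ> S3_a = id" by (simp add: S3_a_def)
  have b3: "S3_b \<circ> S3_b \<circ> S3_b = id"
    by (rule ext) (auto simp: S3_b_def transpose_def)
  have a1: "S3_a \<noteq> id" by (metis S3_a_def id_apply transpose_apply_first n_not_Suc_n numeral_2_eq_2 One_nat_def)
  have "S3_b 3 = 1" by (simp add: S3_b_def transpose_def)
  then have b1: "S3_b \<noteq> id" by auto
  have "ord S3_a dvd 2" using pow_eq_id[OF ab(1), of 2] a2 by (simp add: sg numeral_2_eq_2)
  moreover have "ord S3_a \<noteq> 1" using ord_eq_1[OF ab(1)] a1 by (simp add: sg)
  ultimately have oa: "ord S3_a = 2" using two_is_prime_nat by (auto simp: prime_nat_iff)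
  have pr3: "prime (3::nat)" by simp
  have "ord S3_b dvd 3" using pow_eq_id[OF ab(2), of 3] b3 by (simp add: sg numeral_3_eq_3)
  moreover have "ord S3_b \<noteq> 1" using ord_eq_1[OF ab(2)] b1 by (simp add: sg)
  ultimately have ob: "ord S3_b = 3" using pr3 by (auto simp: prime_nat_iff)
  have invb: "inv\<^bsub>sym_group 3\<^esub> S3_b = transpose 2 3 \<circ> transpose 1 2"
    using perm by (intro inv_equality) (auto simp: sg S3_b_def fun_eq_iff intro: permutes_compose)
  have "S3_b \<otimes>\<^bsub>sym_group 3\<^esub> S3_a = S3_a \<otimes>\<^bsub>sym_group 3\<^esub> inv\<^bsub>sym_group 3\<^esub> S3_b"
    unfolding invb by (simp only: sg S3_a_def S3_b_def comp_assoc)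
  then show ?thesis
    by unfold_locales (use ab oa ob in simp_all)
qed

lemma card_S3: "order (sym_group 3) = 6"
proof -
  have "card {p. p permutes {1..3::nat}} = fact 3" by (rule card_permutations) auto
  then show ?thesis by (simp add: order_def sym_group_def fact_numeral)
qed

lemma psi_cyc_two_power: "3 * psi_cyc (2 ^ k) = 2 ^ (2 * k + 1) + 1"
  using psi_cyc_prime_power[OF two_is_prime_nat, of k] by simp

lemma psi_Z4: "psi (integer_mod_group 4) = 11"
  using psi_integer_mod_group[of 4] psi_cyc_two_power[of 2] by simp

lemma psi_Z8: "psi (integer_mod_group 8) = 43"
  using psi_integer_mod_group[of 8] psi_cyc_two_power[of 3] by simp

lemma S3_extremal:
  "13 / 21 = real (psi (sym_group 3)) / real (psi (integer_mod_group 6)) \<and>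
    noncyclic_even_group (sym_group 3) 6 1 3"
proof -
  interpret dihedral_type "sym_group 3" S3_a S3_b 1 by (rule dihedral_type_S3)
  let ?f = "\<lambda>(i::nat, j::nat). S3_a [^]\<^bsub>sym_group 3\<^esub> i \<otimes>\<^bsub>sym_group 3\<^esub> S3_b [^]\<^bsub>sym_group 3\<^esub> j"
  have fin: "finite (carrier (sym_group 3))"
    using card_S3 order_gt_0_iff_finite by simp
  \<comment> \<open>The six normal forms are distinct and the group has six elements, so they
    exhaust it.\<close>
  have "?f ` ({..<2 ^ 1} \<times> {..<3}) = carrier (sym_group 3)"
  proof (rule card_subset_eq[OF fin])
    show "?f ` ({..<2 ^ 1} \<times> {..<3}) \<subseteq> carrier (sym_group 3)" using A(1) B(1) by auto
    show "card (?f ` ({..<2 ^ 1} \<times> {..<3})) = card (carrier (sym_group 3))"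
      using card_image[OF inj_normal_form] card_S3 by (simp add: order_def)
  qed
  then have gen: "carrier (sym_group 3) \<subseteq> ?f ` ({..<2 ^ 1} \<times> {..<3})" by simp
  have "13 / 21 = real (psi (sym_group 3)) / real (psi (integer_mod_group 6))"
    using psi_ratio_dihedral_type[OF psi_eq[OF gen]] by simp
  then show ?thesis
    using not_cyclic[OF gen] fin card_S3 is_group by (simp add: noncyclic_even_group_def)
qed

lemma Klein_extremal:
  "7 / 11 = real (psi (integer_mod_group 2 \<times>\<times> integer_mod_group 2)) / real (psi (integer_mod_group 4)) \<and>
    noncyclic_even_group (integer_mod_group 2 \<times>\<times> integer_mod_group 2) 4 2 1"
proof -
  let ?V = "integer_mod_group 2 \<times>\<times> integer_mod_group 2"
  interpret group ?V by (simp add: DirProd_group)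
  have carrier: "carrier ?V = {0..<2} \<times> {0..<2}"
    by (simp add: carrier_integer_mod_group)
  have fin: "finite (carrier ?V)" unfolding carrier by simp
  have order: "order ?V = 4" unfolding order_def carrier by simp
  have ord: "ord x = (if x = \<one>\<^bsub>?V\<^esub> then 1 else 2)" if x: "x \<in> carrier ?V" for x
  proof -
    have "x \<otimes>\<^bsub>?V\<^esub> x = \<one>\<^bsub>?V\<^esub>" by (cases x) simp
    then have "x [^]\<^bsub>?V\<^esub> (2::nat) = \<one>\<^bsub>?V\<^esub>" unfolding nat_pow_two[OF x] .
    then have "ord x dvd 2" using pow_eq_id[OF x] by simp
    then have "ord x = 1 \<or> ord x = 2" using two_is_prime_nat by (simp add: prime_nat_iff)
    then show ?thesis using ord_eq_1[OF x] by auto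
  qed
  have "psi ?V = (\<Sum>x\<in>carrier ?V - {\<one>\<^bsub>?V\<^esub>}. 2) + 1"
    unfolding psi_def sum.remove[OF fin one_closed] by (simp add: ord)
  also have "\<dots> = 7" using order fin by (simp add: order_def)
  finally have psi: "psi ?V = 7" .
  have "\<not> cyclic_group ?V"
    unfolding cyclic_group_iff_ord[OF fin] order using ord by auto
  then show ?thesis
    using fin order is_group psi psi_Z4 by (simp add: noncyclic_even_group_def)
qed

text \<open>Proved for all integer quaternions, which spares associativity a case distinction over
  the eight group elements.\<close>

lemma hamilton_mult_assoc: "hamilton_mult (hamilton_mult x y) z = hamilton_mult x (hamilton_mult y z)"
  by (cases x; cases y; cases z) (simp add: algebra_simps)

lemma group_quaternion: "group quaternion_group"
proof (rule groupI)
  fix x y z assume "x \<in> carrier quaternion_group" "y \<in> carrier quaternion_group"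
  then show "x \<otimes>\<^bsub>quaternion_group\<^esub> y \<in> carrier quaternion_group"
    by (auto simp: quaternion_group_def)
  show "x \<otimes>\<^bsub>quaternion_group\<^esub> y \<otimes>\<^bsub>quaternion_group\<^esub> z =
      x \<otimes>\<^bsub>quaternion_group\<^esub> (y \<otimes>\<^bsub>quaternion_group\<^esub> z)"
    by (simp add: quaternion_group_def hamilton_mult_assoc)
next
  fix x assume x: "x \<in> carrier quaternion_group"
  then show "\<one>\<^bsub>quaternion_group\<^esub> \<otimes>\<^bsub>quaternion_group\<^esub> x = x"
    by (auto simp: quaternion_group_def)
  from x show "\<exists>y\<in>carrier quaternion_group. y \<otimes>\<^bsub>quaternion_group\<^esub> x = \<one>\<^bsub>quaternion_group\<^esub>"
    by (auto simp: quaternion_group_def)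
qed (simp add: quaternion_group_def)

lemma quaternion_extremal:
  "27 / 43 = real (psi quaternion_group) / real (psi (integer_mod_group 8)) \<and>
    noncyclic_even_group quaternion_group 8 3 1"
proof -
  interpret group quaternion_group by (rule group_quaternion)
  have fin: "finite (carrier quaternion_group)" by (simp add: quaternion_group_def)
  have order: "order quaternion_group = 8" by (simp add: quaternion_group_def order_def)
  let ?m = "(-1, 0, 0, 0) :: int_quaternion" and ?e = "(1, 0, 0, 0) :: int_quaternion"
  have mem: "?m \<in> carrier quaternion_group" "?e \<in> carrier quaternion_group"
    and one: "\<one>\<^bsub>quaternion_group\<^esub> = ?e" by (simp_all add: quaternion_group_def)
  have mm: "?m \<otimes>\<^bsub>quaternion_group\<^esub> ?m = ?e" by (simp add: quaternion_group_def)
  have "ord ?m dvd 2" using pow_eq_id[OF mem(1), of 2] mm one unfolding nat_pow_two[OF mem(1)] by simp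
  moreover have "ord ?m \<noteq> 1" using ord_eq_1[OF mem(1)] one by simp
  ultimately have om: "ord ?m = 2" using two_is_prime_nat by (auto simp: prime_nat_iff)
  have oe: "ord ?e = 1" using ord_id one by simp
  \<comment> \<open>The six remaining elements square to -1, so their fourth power is trivial and
    their square is not. The order sum is therefore 1 + 2 + 24.\<close>
  have o4: "ord x = 4" if x: "x \<in> carrier quaternion_group - {?e} - {?m}" for x
  proof -
    have xG: "x \<in> carrier quaternion_group" using x by simp
    have "x \<otimes>\<^bsub>quaternion_group\<^esub> x = ?m" using x by (auto simp: quaternion_group_def)
    then have x2: "x [^]\<^bsub>quaternion_group\<^esub> (2::nat) = ?m" unfolding nat_pow_two[OF xG] .
    have "x [^]\<^bsub>quaternion_group\<^esub> (2 * 2 :: nat) = ?e"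
      unfolding nat_pow_pow[OF xG, symmetric] x2 nat_pow_two[OF mem(1)] by (rule mm)
    then have "ord x dvd 2 ^ 2" using pow_eq_id[OF xG, of 4] one by simp
    then obtain k where k: "k \<le> 2" "ord x = 2 ^ k"
      using divides_primepow_nat[OF two_is_prime_nat] by blast
    have "\<not> ord x dvd 2" using pow_eq_id[OF xG, of 2] x2 one by simp
    then have "k \<noteq> 0" "k \<noteq> 1" unfolding k(2) by (intro notI; simp)+
    with k show ?thesis by (cases "k = 2") auto
  qed
  have "psi quaternion_group = ord ?e + (ord ?m + (\<Sum>x\<in>carrier quaternion_group - {?e} - {?m}. ord x))"
    unfolding psi_def sum.remove[OF fin mem(2)]
    using sum.remove[of "carrier quaternion_group - {?e}" ?m ord] fin mem(1) by simp
  also have "(\<Sum>x\<in>carrier quaternion_group - {?e} - {?m}. ord x) = 24"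
    using o4 order fin mem by (simp add: order_def)
  finally have psi: "psi quaternion_group = 27" using om oe by simp
  have "\<not> cyclic_group quaternion_group"
    unfolding cyclic_group_iff_ord[OF fin] order
  proof
    assume "\<exists>x\<in>carrier quaternion_group. ord x = 8"
    then obtain x where x: "x \<in> carrier quaternion_group" "ord x = 8" by blast
    then show False using o4[of x] om oe by (cases "x = ?e"; cases "x = ?m") auto
  qed
  then show ?thesis
    using fin order is_group psi psi_Z8 by (simp add: noncyclic_even_group_def)
qed

section \<open>Evaluation of words in a group\<close>

fun letter_value :: "('b, 'c) monoid_scheme \<Rightarrow> ('g \<Rightarrow> 'b) \<Rightarrow> 'g letter \<Rightarrow> 'b" where
  "letter_value K f (Gen g) = f g"
| "letter_value K f (GenInv g) = inv\<^bsub>K\<^esub> f g"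

fun word_value :: "('b, 'c) monoid_scheme \<Rightarrow> ('g \<Rightarrow> 'b) \<Rightarrow> 'g word \<Rightarrow> 'b" where
  "word_value K f [] = \<one>\<^bsub>K\<^esub>"
| "word_value K f (x # u) = letter_value K f x \<otimes>\<^bsub>K\<^esub> word_value K f u"

context group
begin

lemma letter_value_closed: "(\<And>g. f g \<in> carrier G) \<Longrightarrow> letter_value G f x \<in> carrier G"
  by (cases x) simp_all

lemma word_value_closed: "(\<And>g. f g \<in> carrier G) \<Longrightarrow> word_value G f u \<in> carrier G"
  by (induction u) (simp_all add: letter_value_closed)

lemma word_value_append:
  assumes "\<And>g. f g \<in> carrier G"
  shows "word_value G f (u @ v) = word_value G f u \<otimes> word_value G f v"
  by (induction u) (simp_all add: assms word_value_closed letter_value_closed m_assoc)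

lemma word_value_replicate:
  assumes "\<And>g. f g \<in> carrier G"
  shows "word_value G f (replicate n (Gen g)) = f g [^] n"
  by (induction n) (simp_all add: assms nat_pow_Suc2[symmetric] del: nat_pow_Suc)

text \<open>Von Dyck's principle: an assignment of the generators that satisfies the relations
  respects all their consequences. It is the means of proving that words are not equivalent.\<close>

lemma word_eq_imp_word_value_eq:
  assumes f: "\<And>g. f g \<in> carrier G"
    and R: "\<And>u v. (u, v) \<in> R \<Longrightarrow> word_value G f u = word_value G f v"
    and "word_eq R u v"
  shows "word_value G f u = word_value G f v"
  using assms(3) by induction (simp_all add: f R word_value_append)

end

lemma class_eq_iff: "word_rel R `` {u} = word_rel R `` {v} \<longleftrightarrow> word_eq R u v"
  using eq_equiv_class_iff[OF equiv_word_rel, of u v R] by (simp add: word_rel_def)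

lemma one_presented_group: "\<one>\<^bsub>presented_group R\<^esub> = word_rel R `` {[]}"
  by (simp add: presented_group_def)

lemma class_in_presented_group: "word_rel R `` {u} \<in> carrier (presented_group R)"
  by (simp add: presented_group_def quotientI)

lemma class_replicate:
  "word_rel R `` {replicate n (Gen g)} = (word_rel R `` {[Gen g]}) [^]\<^bsub>presented_group R\<^esub> n"
proof (induction n)
  case (Suc n)
  have "replicate (Suc n) (Gen g) = replicate n (Gen g) @ [Gen g]"
    by (simp add: replicate_append_same)
  then show ?case using Suc by (simp flip: mult_presented_group)
qed (simp add: one_presented_group)

lemma inv_class_Gen:
  "inv\<^bsub>presented_group R\<^esub> (word_rel R `` {[Gen g]}) = word_rel R `` {[GenInv g]}"
proof -
  interpret group "presented_group R" by (rule group_presented_group)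
  show ?thesis
    by (rule inv_equality)
      (simp_all add: mult_presented_group one_presented_group class_eq_iff word_eq_left_inv class_in_presented_group)
qed

section \<open>The presented group of the fourth bound\<close>

definition G1_relations :: "nat \<Rightarrow> (gen_ab word \<times> gen_ab word) set"
  where "G1_relations \<alpha> =
    {(replicate (2 ^ \<alpha>) (Gen gen_ab.a), []), (replicate 3 (Gen gen_ab.b), []),
     ([GenInv gen_ab.a, Gen gen_ab.b, Gen gen_ab.a], [GenInv gen_ab.b])}"

definition G1_a :: "nat \<Rightarrow> gen_ab word set"
  where "G1_a \<alpha> = word_rel (G1_relations \<alpha>) `` {[Gen gen_ab.a]}"

definition G1_b :: "nat \<Rightarrow> gen_ab word set"
  where "G1_b \<alpha> = word_rel (G1_relations \<alpha>) `` {[Gen gen_ab.b]}"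

lemma G1_group_alt: "G1_group \<alpha> = presented_group (G1_relations \<alpha>)"
  by (simp add: G1_group_def G1_relations_def)

text \<open>Sending \<open>a\<close> to a generator of the cyclic group of order 2^\<alpha> and
  \<open>b\<close> to 0 satisfies the relations, so \<open>a\<close> has at least this
  order.\<close>

lemma G1_order_a:
  assumes "G1_a \<alpha> [^]\<^bsub>G1_group \<alpha>\<^esub> (n::nat) = \<one>\<^bsub>G1_group \<alpha>\<^esub>"
  shows "2 ^ \<alpha> dvd n"
proof -
  let ?Z = "integer_mod_group (2 ^ \<alpha>)"
  interpret Z: group ?Z by simp
  \<comment> \<open>The value \<open>1 mod 2 ^ \<alpha>\<close> lies in the carrier also for
    \<alpha> = 0.\<close>
  define f :: "gen_ab \<Rightarrow> int" where "f = (\<lambda>g. case g of gen_ab.a \<Rightarrow> 1 mod 2 ^ \<alpha> | gen_ab.b \<Rightarrow> 0)"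
  have f: "f g \<in> carrier ?Z" for g
    by (cases g) (simp_all add: f_def carrier_integer_mod_group)
  have "word_eq (G1_relations \<alpha>) (replicate n (Gen gen_ab.a)) []"
    using assms unfolding G1_group_alt G1_a_def class_replicate[symmetric] one_presented_group class_eq_iff .
  then have "word_value ?Z f (replicate n (Gen gen_ab.a)) = word_value ?Z f []"
  proof (rule Z.word_eq_imp_word_value_eq[OF f, rotated])
    fix u v assume "(u, v) \<in> G1_relations \<alpha>"
    then show "word_value ?Z f u = word_value ?Z f v"
      using f[of gen_ab.a] f[of gen_ab.b]
      by (auto simp: G1_relations_def Z.word_value_replicate[OF f])
        (auto simp: f_def mod_simps)
  qed
  then have "(int n * (1 mod 2 ^ \<alpha>)) mod 2 ^ \<alpha> = 0"
    unfolding Z.word_value_replicate[OF f] by (simp add: f_def)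
  then have "int n mod int (2 ^ \<alpha>) = 0"
    by (simp only: mod_mult_right_eq mult_1_right of_nat_power of_nat_numeral)
  then show ?thesis by (metis int_dvd_int_iff mod_eq_0_iff_dvd)
qed

text \<open>The relations hold in \<open>S\<^sub>3\<close>, where \<open>b\<close> becomes a
  3-cycle; \<alpha> \<ge> 1 makes the 2^\<alpha>-th power of a transposition trivial.\<close>

lemma G1_b_nontrivial:
  assumes "\<alpha> \<ge> 1"
  shows "G1_b \<alpha> \<noteq> \<one>\<^bsub>G1_group \<alpha>\<^esub>"
proof
  interpret S: dihedral_type "sym_group 3" S3_a S3_b 1 by (rule dihedral_type_S3)
  define f where "f = (\<lambda>g. case g of gen_ab.a \<Rightarrow> S3_a | gen_ab.b \<Rightarrow> S3_b)"
  have f: "f g \<in> carrier (sym_group 3)" for g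
    using S.A(1) S.B(1) by (cases g) (simp_all add: f_def)
  assume "G1_b \<alpha> = \<one>\<^bsub>G1_group \<alpha>\<^esub>"
  then have "word_eq (G1_relations \<alpha>) [Gen gen_ab.b] []"
    unfolding G1_group_alt G1_b_def one_presented_group class_eq_iff .
  then have "word_value (sym_group 3) f [Gen gen_ab.b] = word_value (sym_group 3) f []"
  proof (rule S.word_eq_imp_word_value_eq[OF f, rotated])
    fix u v assume uv: "(u, v) \<in> G1_relations \<alpha>"
    have "S3_a [^]\<^bsub>sym_group 3\<^esub> ((2::nat) ^ \<alpha>) = \<one>\<^bsub>sym_group 3\<^esub>"
      using S.A assms S.pow_eq_id by simp
    moreover have "S3_b [^]\<^bsub>sym_group 3\<^esub> (3::nat) = \<one>\<^bsub>sym_group 3\<^esub>"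
      using S.B S.pow_eq_id by simp
    moreover have "inv\<^bsub>sym_group 3\<^esub> S3_a \<otimes>\<^bsub>sym_group 3\<^esub> (S3_b \<otimes>\<^bsub>sym_group 3\<^esub> S3_a) = inv\<^bsub>sym_group 3\<^esub> S3_b"
      by (rule S.conj_A)
    ultimately show "word_value (sym_group 3) f u = word_value (sym_group 3) f v"
      using uv S.A(1) S.B(1) S.inv_closed[OF S.B(1)]
      by (auto simp: G1_relations_def S.word_value_replicate[OF f]) (auto simp: f_def)
  qed
  then have "S3_b = \<one>\<^bsub>sym_group 3\<^esub>" using S.B(1) by (simp add: f_def)
  then show False using S.B(2) S.ord_id by simp
qed

text \<open>The relations bound the orders of the two generators from above; the maps to a cyclic
  group and to \<open>S\<^sub>3\<close> bound them from below.\<close>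

lemma dihedral_type_G1:
  assumes "\<alpha> \<ge> 1"
  shows "dihedral_type (G1_group \<alpha>) (G1_a \<alpha>) (G1_b \<alpha>) \<alpha>"
proof -
  interpret group "G1_group \<alpha>" unfolding G1_group_alt by (rule group_presented_group)
  have ab: "G1_a \<alpha> \<in> carrier (G1_group \<alpha>)" "G1_b \<alpha> \<in> carrier (G1_group \<alpha>)"
    unfolding G1_group_alt G1_a_def G1_b_def by (rule class_in_presented_group)+
  have a1: "G1_a \<alpha> [^]\<^bsub>G1_group \<alpha>\<^esub> ((2::nat) ^ \<alpha>) = \<one>\<^bsub>G1_group \<alpha>\<^esub>"
    unfolding G1_group_alt G1_a_def class_replicate[symmetric] one_presented_group class_eq_iff
    by (rule word_eq_relation) (simp add: G1_relations_def)
  have b1: "G1_b \<alpha> [^]\<^bsub>G1_group \<alpha>\<^esub> (3::nat) = \<one>\<^bsub>G1_group \<alpha>\<^esub>"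
    unfolding G1_group_alt G1_b_def class_replicate[symmetric] one_presented_group class_eq_iff
    by (rule word_eq_relation) (simp add: G1_relations_def)
  have "ord (G1_a \<alpha>) dvd 2 ^ \<alpha>" using a1 pow_eq_id[OF ab(1)] by simp
  moreover have "2 ^ \<alpha> dvd ord (G1_a \<alpha>)" using G1_order_a[OF pow_ord_eq_1[OF ab(1)]] .
  ultimately have oa: "ord (G1_a \<alpha>) = 2 ^ \<alpha>" by (rule dvd_antisym)
  have "ord (G1_b \<alpha>) dvd 3" using b1 pow_eq_id[OF ab(2)] by simp
  moreover have "ord (G1_b \<alpha>) \<noteq> 1" using ord_eq_1[OF ab(2)] G1_b_nontrivial[OF assms] by simp
  moreover have "prime (3::nat)" by simp
  ultimately have ob: "ord (G1_b \<alpha>) = 3" by (auto simp: prime_nat_iff)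
  have "inv\<^bsub>G1_group \<alpha>\<^esub> G1_a \<alpha> \<otimes>\<^bsub>G1_group \<alpha>\<^esub> (G1_b \<alpha> \<otimes>\<^bsub>G1_group \<alpha>\<^esub> G1_a \<alpha>) = inv\<^bsub>G1_group \<alpha>\<^esub> G1_b \<alpha>"
    unfolding G1_group_alt G1_a_def G1_b_def inv_class_Gen mult_presented_group class_eq_iff
    by (rule word_eq_relation) (simp add: G1_relations_def)
  then have "G1_b \<alpha> \<otimes>\<^bsub>G1_group \<alpha>\<^esub> G1_a \<alpha> = G1_a \<alpha> \<otimes>\<^bsub>G1_group \<alpha>\<^esub> inv\<^bsub>G1_group \<alpha>\<^esub> G1_b \<alpha>"
    using ab inv_solve_left[of "inv\<^bsub>G1_group \<alpha>\<^esub> G1_b \<alpha>" "G1_a \<alpha>"] by (simp add: inv_solve_left')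
  with ab oa ob assms show ?thesis by unfold_locales
qed

text \<open>Left multiplication by either generator preserves the shape A^i B^j, and inverse letters
  are nonnegative powers, so induction on words reaches every class. This gives the upper bound on
  the group order.\<close>

lemma G1_normal_form:
  assumes "\<alpha> \<ge> 1"
  shows "carrier (G1_group \<alpha>) \<subseteq>
    (\<lambda>(i::nat, j::nat). G1_a \<alpha> [^]\<^bsub>G1_group \<alpha>\<^esub> i \<otimes>\<^bsub>G1_group \<alpha>\<^esub> G1_b \<alpha> [^]\<^bsub>G1_group \<alpha>\<^esub> j) `
      ({..<2 ^ \<alpha>} \<times> {..<3})"
proof -
  interpret dihedral_type "G1_group \<alpha>" "G1_a \<alpha>" "G1_b \<alpha>" \<alpha> by (rule dihedral_type_G1[OF assms])
  let ?A = "G1_a \<alpha>" and ?B = "G1_b \<alpha>"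
  note [simp] = A(1) B(1)
  let ?NF = "{x. \<exists>(i::nat) (j::nat). x = ?A [^]\<^bsub>G1_group \<alpha>\<^esub> i \<otimes>\<^bsub>G1_group \<alpha>\<^esub> ?B [^]\<^bsub>G1_group \<alpha>\<^esub> j}"
  have A_NF: "?A [^]\<^bsub>G1_group \<alpha>\<^esub> (k::nat) \<otimes>\<^bsub>G1_group \<alpha>\<^esub> x \<in> ?NF" if x: "x \<in> ?NF" for x k
  proof -
    obtain i j :: nat where "x = ?A [^]\<^bsub>G1_group \<alpha>\<^esub> i \<otimes>\<^bsub>G1_group \<alpha>\<^esub> ?B [^]\<^bsub>G1_group \<alpha>\<^esub> j" using x by blast
    then have "?A [^]\<^bsub>G1_group \<alpha>\<^esub> k \<otimes>\<^bsub>G1_group \<alpha>\<^esub> x =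
        ?A [^]\<^bsub>G1_group \<alpha>\<^esub> (k + i) \<otimes>\<^bsub>G1_group \<alpha>\<^esub> ?B [^]\<^bsub>G1_group \<alpha>\<^esub> j"
      by (simp add: nat_pow_mult flip: m_assoc)
    then show ?thesis by blast
  qed
  \<comment> \<open>Each passage across \<open>?A\<close> doubles the exponent of \<open>?B\<close>,
    because inversion is squaring here; only the existence of the final exponent is kept.\<close>
  have BA_pow: "\<exists>e::nat. ?B \<otimes>\<^bsub>G1_group \<alpha>\<^esub> ?A [^]\<^bsub>G1_group \<alpha>\<^esub> i =
      ?A [^]\<^bsub>G1_group \<alpha>\<^esub> i \<otimes>\<^bsub>G1_group \<alpha>\<^esub> ?B [^]\<^bsub>G1_group \<alpha>\<^esub> e" for i :: nat
  proof (induction i)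
    case 0
    have "?B \<otimes>\<^bsub>G1_group \<alpha>\<^esub> ?A [^]\<^bsub>G1_group \<alpha>\<^esub> (0::nat) =
      ?A [^]\<^bsub>G1_group \<alpha>\<^esub> (0::nat) \<otimes>\<^bsub>G1_group \<alpha>\<^esub> ?B [^]\<^bsub>G1_group \<alpha>\<^esub> (1::nat)" by simp
    then show ?case by blast
  next
    case (Suc i)
    then obtain e :: nat where e: "?B \<otimes>\<^bsub>G1_group \<alpha>\<^esub> ?A [^]\<^bsub>G1_group \<alpha>\<^esub> i =
      ?A [^]\<^bsub>G1_group \<alpha>\<^esub> i \<otimes>\<^bsub>G1_group \<alpha>\<^esub> ?B [^]\<^bsub>G1_group \<alpha>\<^esub> e" by blast
    have "?B \<otimes>\<^bsub>G1_group \<alpha>\<^esub> ?A [^]\<^bsub>G1_group \<alpha>\<^esub> Suc i =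
        (?B \<otimes>\<^bsub>G1_group \<alpha>\<^esub> ?A [^]\<^bsub>G1_group \<alpha>\<^esub> i) \<otimes>\<^bsub>G1_group \<alpha>\<^esub> ?A"
      by (simp add: m_assoc)
    also have "\<dots> = ?A [^]\<^bsub>G1_group \<alpha>\<^esub> i \<otimes>\<^bsub>G1_group \<alpha>\<^esub> (?B [^]\<^bsub>G1_group \<alpha>\<^esub> e \<otimes>\<^bsub>G1_group \<alpha>\<^esub> ?A)"
      unfolding e by (simp add: m_assoc)
    also have "\<dots> = ?A [^]\<^bsub>G1_group \<alpha>\<^esub> Suc i \<otimes>\<^bsub>G1_group \<alpha>\<^esub> ?B [^]\<^bsub>G1_group \<alpha>\<^esub> (2 * e)"
      unfolding Bj_A inv_B by (simp add: m_assoc nat_pow_pow)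
    finally show ?case by blast
  qed
  have B_NF: "?B \<otimes>\<^bsub>G1_group \<alpha>\<^esub> x \<in> ?NF" if x: "x \<in> ?NF" for x
  proof -
    obtain i j :: nat where ij: "x = ?A [^]\<^bsub>G1_group \<alpha>\<^esub> i \<otimes>\<^bsub>G1_group \<alpha>\<^esub> ?B [^]\<^bsub>G1_group \<alpha>\<^esub> j" using x by blast
    obtain e :: nat where e: "?B \<otimes>\<^bsub>G1_group \<alpha>\<^esub> ?A [^]\<^bsub>G1_group \<alpha>\<^esub> i =
      ?A [^]\<^bsub>G1_group \<alpha>\<^esub> i \<otimes>\<^bsub>G1_group \<alpha>\<^esub> ?B [^]\<^bsub>G1_group \<alpha>\<^esub> e" using BA_pow by blast
    have "?B \<otimes>\<^bsub>G1_group \<alpha>\<^esub> x = (?B \<otimes>\<^bsub>G1_group \<alpha>\<^esub> ?A [^]\<^bsub>G1_group \<alpha>\<^esub> i) \<otimes>\<^bsub>G1_group \<alpha>\<^esub> ?B [^]\<^bsub>G1_group \<alpha>\<^esub> j"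
      unfolding ij by (simp add: m_assoc)
    also have "\<dots> = ?A [^]\<^bsub>G1_group \<alpha>\<^esub> i \<otimes>\<^bsub>G1_group \<alpha>\<^esub> ?B [^]\<^bsub>G1_group \<alpha>\<^esub> (e + j)"
      unfolding e by (simp add: m_assoc nat_pow_mult)
    finally show ?thesis by blast
  qed
  \<comment> \<open>Written with a natural exponent so that \<open>A_NF\<close> covers the inverse
    letter as well.\<close>
  have inv_A: "inv\<^bsub>G1_group \<alpha>\<^esub> ?A = ?A [^]\<^bsub>G1_group \<alpha>\<^esub> ((2::nat) ^ \<alpha> - 1)"
  proof (rule inv_equality)
    have "?A [^]\<^bsub>G1_group \<alpha>\<^esub> ((2::nat) ^ \<alpha> - 1) \<otimes>\<^bsub>G1_group \<alpha>\<^esub> ?A =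
        ?A [^]\<^bsub>G1_group \<alpha>\<^esub> Suc ((2::nat) ^ \<alpha> - 1)"
      by (rule nat_pow_Suc[symmetric])
    also have "Suc ((2::nat) ^ \<alpha> - 1) = ord ?A" unfolding A(2) by simp
    finally show "?A [^]\<^bsub>G1_group \<alpha>\<^esub> ((2::nat) ^ \<alpha> - 1) \<otimes>\<^bsub>G1_group \<alpha>\<^esub> ?A = \<one>\<^bsub>G1_group \<alpha>\<^esub>"
      using pow_ord_eq_1[OF A(1)] by (rule trans)
  qed simp_all
  have class_NF: "word_rel (G1_relations \<alpha>) `` {u} \<in> ?NF" for u
  proof (induction u)
    case Nil
    have "word_rel (G1_relations \<alpha>) `` {[]} =
      ?A [^]\<^bsub>G1_group \<alpha>\<^esub> (0::nat) \<otimes>\<^bsub>G1_group \<alpha>\<^esub> ?B [^]\<^bsub>G1_group \<alpha>\<^esub> (0::nat)"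
      by (simp add: G1_group_alt one_presented_group[symmetric]
          monoid.l_one[OF group.is_monoid[OF group_presented_group]] monoid.one_closed[OF group.is_monoid[OF group_presented_group]])
    then show ?case by blast
  next
    case (Cons x u)
    have split: "word_rel (G1_relations \<alpha>) `` {x # u} =
        word_rel (G1_relations \<alpha>) `` {[x]} \<otimes>\<^bsub>G1_group \<alpha>\<^esub> word_rel (G1_relations \<alpha>) `` {u}"
      unfolding G1_group_alt mult_presented_group by simp
    have closed: "word_rel (G1_relations \<alpha>) `` {u} \<in> carrier (G1_group \<alpha>)"
      unfolding G1_group_alt by (rule class_in_presented_group)
    consider "x = Gen gen_ab.a" | "x = GenInv gen_ab.a" | "x = Gen gen_ab.b" | "x = GenInv gen_ab.b"
      by (metis gen_ab.exhaust letter.exhaust)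
    then show ?case
    proof cases
      case 1
      then have "word_rel (G1_relations \<alpha>) `` {[x]} = ?A" by (simp add: G1_a_def)
      then show ?thesis using A_NF[OF Cons, of 1] unfolding split by simp
    next
      case 2
      then have "word_rel (G1_relations \<alpha>) `` {[x]} = inv\<^bsub>G1_group \<alpha>\<^esub> ?A"
        by (simp add: G1_group_alt G1_a_def inv_class_Gen)
      then show ?thesis using A_NF[OF Cons] unfolding split inv_A by simp
    next
      case 3
      then have "word_rel (G1_relations \<alpha>) `` {[x]} = ?B" by (simp add: G1_b_def)
      then show ?thesis using B_NF[OF Cons] unfolding split by simp
    next
      case 4
      then have "word_rel (G1_relations \<alpha>) `` {[x]} = inv\<^bsub>G1_group \<alpha>\<^esub> ?B"
        by (simp add: G1_group_alt G1_b_def inv_class_Gen)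
      also have "\<dots> = ?B \<otimes>\<^bsub>G1_group \<alpha>\<^esub> ?B" unfolding inv_B by (simp add: numeral_2_eq_2)
      finally show ?thesis
        using B_NF[OF B_NF[OF Cons]] closed unfolding split by (simp add: m_assoc)
    qed
  qed
  show ?thesis
  proof
    fix X assume "X \<in> carrier (G1_group \<alpha>)"
    then obtain u where "X = word_rel (G1_relations \<alpha>) `` {u}"
      by (auto simp: G1_group_alt presented_group_def quotient_def)
    then obtain i j :: nat where X: "X = ?A [^]\<^bsub>G1_group \<alpha>\<^esub> i \<otimes>\<^bsub>G1_group \<alpha>\<^esub> ?B [^]\<^bsub>G1_group \<alpha>\<^esub> j"
      using class_NF[of u] by blast
    have "X = ?A [^]\<^bsub>G1_group \<alpha>\<^esub> (i mod 2 ^ \<alpha>) \<otimes>\<^bsub>G1_group \<alpha>\<^esub> ?B [^]\<^bsub>G1_group \<alpha>\<^esub> (j mod 3)"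
      using pow_mod_ord[OF A(1), of i] pow_mod_ord[OF B(1), of j] unfolding A(2) B(2) X by simp
    then show "X \<in> (\<lambda>(i::nat, j::nat). ?A [^]\<^bsub>G1_group \<alpha>\<^esub> i \<otimes>\<^bsub>G1_group \<alpha>\<^esub> ?B [^]\<^bsub>G1_group \<alpha>\<^esub> j) `
      ({..<2 ^ \<alpha>} \<times> {..<3})"
      by (intro image_eqI[of _ _ "(i mod 2 ^ \<alpha>, j mod 3)"]) auto
  qed
qed

lemma G1_extremal:
  assumes "\<alpha> \<ge> 1"
  shows "(2 ^ (2 * \<alpha> + 3) + 7) / (7 * (2 ^ (2 * \<alpha> + 1) + 1)) =
      real (psi (G1_group \<alpha>)) / real (psi (integer_mod_group (2 ^ \<alpha> * 3))) \<and>
    noncyclic_even_group (G1_group \<alpha>) (2 ^ \<alpha> * 3) \<alpha> 3"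
proof -
  interpret dihedral_type "G1_group \<alpha>" "G1_a \<alpha>" "G1_b \<alpha>" \<alpha> by (rule dihedral_type_G1[OF assms])
  note gen = G1_normal_form[OF assms]
  have "finite (carrier (G1_group \<alpha>))" unfolding carrier_eq[OF gen] by simp
  then show ?thesis
    using psi_ratio_dihedral_type[OF psi_eq[OF gen]] not_cyclic[OF gen] order_eq[OF gen] is_group assms
    by (simp add: noncyclic_even_group_def)
qed

theorem theorem6:
  shows
    "(\<forall>(G :: 'a monoid) n \<alpha> m. noncyclic_even_group G n \<alpha> m \<longrightarrow>
        (\<alpha> = 1 \<longrightarrow> real (psi G) / real (psi (integer_mod_group n)) \<le> 13 / 21) \<and>
        (\<alpha> = 2 \<longrightarrow> real (psi G) / real (psi (integer_mod_group n)) \<le> 7 / 11) \<and>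
        (\<alpha> = 3 \<longrightarrow> real (psi G) / real (psi (integer_mod_group n)) \<le> 27 / 43) \<and>
        (\<alpha> \<ge> 4 \<longrightarrow> real (psi G) / real (psi (integer_mod_group n))
            \<le> (2 ^ (2 * \<alpha> + 3) + 7) / (7 * (2 ^ (2 * \<alpha> + 1) + 1)))) \<and>
     (13 / 21 = real (psi (sym_group 3)) / real (psi (integer_mod_group 6)) \<and>
        noncyclic_even_group (sym_group 3) 6 1 3) \<and>
     (7 / 11 = real (psi (integer_mod_group 2 \<times>\<times> integer_mod_group 2))
                 / real (psi (integer_mod_group 4)) \<and>
        noncyclic_even_group (integer_mod_group 2 \<times>\<times> integer_mod_group 2) 4 2 1) \<and>
     (27 / 43 = real (psi quaternion_group) / real (psi (integer_mod_group 8)) \<and>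
        noncyclic_even_group quaternion_group 8 3 1) \<and>
     (\<forall>\<alpha>\<ge>4. (2 ^ (2 * \<alpha> + 3) + 7) / (7 * (2 ^ (2 * \<alpha> + 1) + 1))
                 = real (psi (G1_group \<alpha>)) / real (psi (integer_mod_group (2 ^ \<alpha> * 3))) \<and>
        noncyclic_even_group (G1_group \<alpha>) (2 ^ \<alpha> * 3) \<alpha> 3)"
proof (intro conjI)
  show "\<forall>(G :: 'a monoid) n \<alpha> m. noncyclic_even_group G n \<alpha> m \<longrightarrow>
        (\<alpha> = 1 \<longrightarrow> real (psi G) / real (psi (integer_mod_group n)) \<le> 13 / 21) \<and>
        (\<alpha> = 2 \<longrightarrow> real (psi G) / real (psi (integer_mod_group n)) \<le> 7 / 11) \<and>
        (\<alpha> = 3 \<longrightarrow> real (psi G) / real (psi (integer_mod_group n)) \<le> 27 / 43) \<and>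
        (\<alpha> \<ge> 4 \<longrightarrow> real (psi G) / real (psi (integer_mod_group n))
            \<le> (2 ^ (2 * \<alpha> + 3) + 7) / (7 * (2 ^ (2 * \<alpha> + 1) + 1)))"
  proof (intro allI impI)
    fix G :: "'a monoid" and n \<alpha> m
    assume "noncyclic_even_group G n \<alpha> m"
    then have "real (psi G) / real (psi (integer_mod_group n)) \<le> even_ratio \<alpha>"
      by (rule noncyclic_even_group_ratio_le)
    then show "(\<alpha> = 1 \<longrightarrow> real (psi G) / real (psi (integer_mod_group n)) \<le> 13 / 21) \<and>
        (\<alpha> = 2 \<longrightarrow> real (psi G) / real (psi (integer_mod_group n)) \<le> 7 / 11) \<and>
        (\<alpha> = 3 \<longrightarrow> real (psi G) / real (psi (integer_mod_group n)) \<le> 27 / 43) \<and>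
        (\<alpha> \<ge> 4 \<longrightarrow> real (psi G) / real (psi (integer_mod_group n))
            \<le> (2 ^ (2 * \<alpha> + 3) + 7) / (7 * (2 ^ (2 * \<alpha> + 1) + 1)))"
      by (auto simp: even_ratio_def G1_ratio_def)
  qed
next
  show "\<forall>\<alpha>\<ge>4. (2 ^ (2 * \<alpha> + 3) + 7) / (7 * (2 ^ (2 * \<alpha> + 1) + 1))
                 = real (psi (G1_group \<alpha>)) / real (psi (integer_mod_group (2 ^ \<alpha> * 3))) \<and>
        noncyclic_even_group (G1_group \<alpha>) (2 ^ \<alpha> * 3) \<alpha> 3"
    using G1_extremal by simp
qed (use S3_extremal Klein_extremal quaternion_extremal in blast)+

end
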